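(* Let $L$ be a projective link diagram. The natural chain map $$\alpha: C_{MW}(L)\to C_{DKK}(L),\qquad [s]\mapsto[\pi(s)],$$ from the unlabeled Manolescu–Willis complex of $L$ to the Dye–Kaestner–Kauffman complex of the virtual diagram $\pi(L)$, induces isomorphisms on the cohomology groups.
   Context: Projective diagrams and $\pi$. $\mathbb{R}P^2$ is represented as a closed disk with antipodal boundary points identified. A link in $\mathbb{R}P^3$ is represented by a projective link diagram: a tangle diagram in the disk whose endpoints lie on the boundary circle and form antipodal pairs. Given such a diagram $L$ (or a crossingless state $s$ of it), regard the disk as embedded in the plane; for each antipodal pair of endpoints draw an arc in the complement of the disk joining them, all crossings between these arcs being declared virtual. The resulting virtual diagram is $\pi(L)$ (resp. $\pi(s)$). Fix an orientation of $L$; it orients $\pi(L)$. Common data. Vertices of the cube of resolutions are the states ($A$- or $B$-smoothing at every classical crossing); edges change one $A$-smoothing to a $B$-smoothing. $V$ is the $\mathbb{Q}$-vector space with basis $\{1,X\}$, with $m(1\otimes1)=1$, $m(1\otimes X)=m(X\otimes1)=X$, $m(X\otimes X)=0$, $\Delta(1)=1\otimes X+X\otimes1$, $\Delta(X)=X\otimes X$; $\overline{a1+bX}=a1-bX$. A state with $n$ circles is assigned $V^{\otimes n}$. An edge merging two circles uses $m$, one splitting a circle uses $\Delta$, and one turning one circle into one circle uses the zero map, with signs as below; the differential is the sum of all edge maps. At each crossing, drawn with both strands oriented upwards, the arcs of the smoothings get local orientations: left arc up, right arc down (vertical smoothing); bottom arc rightwards, top arc leftwards (horizontal smoothing). Permutation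 rule (both theories): circles of each state are numbered; for an edge, in the source and in the target state permute the numbering so that the involved circles come first, when there are two in the order left before right (vertical smoothing) or top before bottom (horizontal smoothing), the others keeping their relative order; multiply the map by the signs of both permutations. $C_{DKK}(L)$: the complex of $\pi(L)$. The local orientations are those induced by the source–sink orientation SW in, SE out, NE in, NW out at each crossing (strands oriented upwards); a cut point is placed on each half-edge where this disagrees with the orientation of $\pi(L)$, so on a state circle the local orientation switches exactly at cut points. Each state circle carries a base point, whose local orientation gives a global orientation of the circle. Elements are transported along the global orientation from base points to the site of the bifurcation, then $m$ or $\Delta$ is applied, then results are transported to the new base points; elements on uninvolved circles are transported from old to new base point. Each passage through a cut point bars the element. $C_{MW}(L)$ (unlabeled): states are circles in $\mathbb{R}P^2$; each circle of each state is given a numbering and a global orientation; here the algebra for homotopically nontrivial circles (generated by $1,\overline X$ in Manolescu–Willis) is identified with $V$ by replacing $\overline X$ with $X$, so null-homotopic and non-null-homotopic circles are not distinguished. Signs: the permutation rule; the nearby consistency rule (for each arc at the site, before and after the bifurcation, whose local orientation disagrees with the global orientation of its circle, $X$ on that circle is replaced by $-X$); and the far orientations rule (multiply by $-1$ for each circle not passing through the site, carrying $X$, whose global orientations before and after the bifurcation differ). The map $\alpha$. Local orientations at crossings in the MW complex are taken from the orientation of $L$, the numbering of circles of $s$ and of $\pi(s)$ correspond, and the global orientation of each circle of $s$ is the orientation at the base point of the corresponding circle of $\pi(s)$. $\alpha$ sends a state $s$ with its labels by elements of $V$ to the state $\pi(s)$ with the same labels. *)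

theory Defs
  imports
    Complex_Main
    "HOL-Algebra.Coset"
    "HOL-Combinatorics.Orbits"
    "HOL-Combinatorics.Permutations"
    "HOL-Library.Disjoint_Sets"
begin

section \<open>Oriented diagrams as combinatorial data\<close>

text \<open>
  Every crossing is drawn with both strands oriented upwards; its four half-edges are named after
  the compass. The strands run from SW to NE and from SE to NW.
\<close>

datatype corner = SW | SE | NE | NW

definition incoming :: "corner \<Rightarrow> bool" where
  "incoming k \<longleftrightarrow> k = SW \<or> k = SE"

datatype ('c, 'p) vertex = Corner 'c corner | Point 'p

text \<open>
  An oriented 4-valent graph on a closed surface: crossings, together with bivalent points
  subdividing the edges. \<open>next\<close> sends the half-edge by which a strand leaves a crossing (or
  a bivalent point it leaves) to the half-edge (or bivalent point) where the strand arrives, i.e.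
  an edge is named by its tail. A closed component without crossings must carry a bivalent point.
  A crossing is positive if the strand from SW to NE is the overstrand.
\<close>

record ('c, 'p) diagram =
  crossings :: "'c set"
  positive :: "'c \<Rightarrow> bool"
  points :: "'p set"
  "next" :: "('c, 'p) vertex \<Rightarrow> ('c, 'p) vertex"

text \<open>
  A virtual diagram has, in addition, virtual crossings. The two strands of a virtual crossing pass
  straight through it, so each of them has a bivalent point there; the virtual crossing is the
  pair of these two points.
\<close>

record ('c, 'p) virtual_diagram = "('c, 'p) diagram" +
  vcrossings :: "'p set set"

definition tails :: "('c, 'p, 'z) diagram_scheme \<Rightarrow> ('c, 'p) vertex set" where
  "tails D = {Corner c k |c k. c \<in> crossings D \<and> \<not> incoming k} \<union> Point ` points D"

definition heads :: "('c, 'p, 'z) diagram_scheme \<Rightarrow> ('c, 'p) vertex set" where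
  "heads D = {Corner c k |c k. c \<in> crossings D \<and> incoming k} \<union> Point ` points D"

definition prev :: "('c, 'p, 'z) diagram_scheme \<Rightarrow> ('c, 'p) vertex \<Rightarrow> ('c, 'p) vertex" where
  "prev D v = inv_into (tails D) (next D) v"


section \<open>Projective diagrams\<close>

text \<open>
  An oriented tangle diagram in the disk. The \<open>2 * pairs L\<close> endpoints are numbered
  counterclockwise along the boundary circle. \<open>arc\<close> sends the beginning of each strand of the
  underlying graph (an outgoing half-edge of a crossing, or an endpoint where the strand enters the
  disk) to its end. \<open>loops\<close> counts the closed components in the disk that have no crossing.
\<close>

record 'c tangle =
  tcrossings :: "'c set"
  tpositive :: "'c \<Rightarrow> bool"
  loops :: nat
  pairs :: nat
  entering :: "nat set"
  arc :: "('c, nat) vertex \<Rightarrow> ('c, nat) vertex"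

definition endpoints :: "'c tangle \<Rightarrow> nat set" where
  "endpoints L = {..<2 * pairs L}"

definition antipode :: "'c tangle \<Rightarrow> nat \<Rightarrow> nat" where
  "antipode L e = (e + pairs L) mod (2 * pairs L)"

definition tangle_tails :: "'c tangle \<Rightarrow> ('c, nat) vertex set" where
  "tangle_tails L =
     {Corner c k |c k. c \<in> tcrossings L \<and> \<not> incoming k} \<union> Point ` (endpoints L \<inter> entering L)"

definition tangle_heads :: "'c tangle \<Rightarrow> ('c, nat) vertex set" where
  "tangle_heads L =
     {Corner c k |c k. c \<in> tcrossings L \<and> incoming k} \<union> Point ` (endpoints L - entering L)"

text \<open>
  Planarity. The tangle together with the boundary circle is a graph in the sphere, given by its
  rotation system: \<open>rotate\<close> is the counterclockwise rotation of the darts (half-edges) at a vertex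
  and \<open>opposite\<close> exchanges the two darts of an edge. \<open>Ccw e\<close> and \<open>Cw e\<close> are the darts on the boundary
  circle pointing from \<open>e\<close> to the next endpoint in counterclockwise and clockwise direction. The
  rotation system is that of a plane drawing iff all components have Euler characteristic 2.
\<close>

datatype 'c dart = Strand "('c, nat) vertex" | Ccw nat | Cw nat

definition darts :: "'c tangle \<Rightarrow> 'c dart set" where
  "darts L = Strand ` (tangle_tails L \<union> tangle_heads L) \<union> Ccw ` endpoints L \<union> Cw ` endpoints L"

fun turn :: "corner \<Rightarrow> corner" where
  "turn SW = SE" | "turn SE = NE" | "turn NE = NW" | "turn NW = SW"

fun rotate :: "'c dart \<Rightarrow> 'c dart" where
  "rotate (Strand (Corner c k)) = Strand (Corner c (turn k))"
| "rotate (Ccw e) = Strand (Point e)"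
| "rotate (Strand (Point e)) = Cw e"
| "rotate (Cw e) = Ccw e"

fun opposite :: "'c tangle \<Rightarrow> 'c dart \<Rightarrow> 'c dart" where
  "opposite L (Strand v) =
     Strand (if v \<in> tangle_tails L then arc L v else inv_into (tangle_tails L) (arc L) v)"
| "opposite L (Ccw e) = Cw (Suc e mod (2 * pairs L))"
| "opposite L (Cw e) = Ccw ((e + 2 * pairs L - 1) mod (2 * pairs L))"

definition num_orbits :: "('d \<Rightarrow> 'd) \<Rightarrow> 'd set \<Rightarrow> nat" where
  "num_orbits f A = card (orbit f ` A)"

definition num_components :: "'c tangle \<Rightarrow> nat" where
  "num_components L = card ((\<lambda>x. {(y, z). z = rotate y \<or> z = opposite L y}\<^sup>* `` {x}) ` darts L)"

definition planar :: "'c tangle \<Rightarrow> bool" where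
  "planar L \<longleftrightarrow>
     int (num_orbits rotate (darts L)) - int (num_orbits (opposite L) (darts L))
       + int (num_orbits (rotate \<circ> opposite L) (darts L)) = 2 * int (num_components L)"

text \<open>
  The third condition says that the orientation of the strands is compatible with the
  identification of antipodal endpoints, i.e. it is an orientation of the link.
\<close>

definition projective_diagram :: "'c tangle \<Rightarrow> bool" where
  "projective_diagram L \<longleftrightarrow>
     finite (tcrossings L) \<and>
     entering L \<subseteq> endpoints L \<and>
     (\<forall>e \<in> endpoints L. e \<in> entering L \<longleftrightarrow> antipode L e \<notin> entering L) \<and>
     bij_betw (arc L) (tangle_tails L) (tangle_heads L) \<and>
     planar L"

text \<open>
  The graph in the projective plane obtained by identifying antipodal endpoints;
  \<open>Bdry i\<close> is the common image of the endpoints \<open>i\<close> and \<open>i + pairs L\<close>.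
\<close>

datatype rp2_point = Loop nat | Bdry nat

fun glue :: "'c tangle \<Rightarrow> ('c, nat) vertex \<Rightarrow> ('c, rp2_point) vertex" where
  "glue L (Corner c k) = Corner c k"
| "glue L (Point e) = Point (Bdry (e mod pairs L))"

fun rp2_next :: "'c tangle \<Rightarrow> ('c, rp2_point) vertex \<Rightarrow> ('c, rp2_point) vertex" where
  "rp2_next L (Corner c k) = glue L (arc L (Corner c k))"
| "rp2_next L (Point (Bdry i)) =
     glue L (arc L (Point (if i \<in> entering L then i else antipode L i)))"
| "rp2_next L (Point (Loop j)) = Point (Loop j)"

definition rp2_diagram :: "'c tangle \<Rightarrow> ('c, rp2_point) diagram" where
  "rp2_diagram L =
     \<lparr>crossings = tcrossings L, positive = tpositive L,
      points = Loop ` {..<loops L} \<union> Bdry ` {..<pairs L}, next = rp2_next L\<rparr>"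


section \<open>The virtual diagram \<open>\<pi>(L)\<close>\<close>

text \<open>
  A drawing of the outer arcs: the arc leaving the disk at the endpoint \<open>e\<close> (and returning at its
  antipode) runs through \<open>passages A e\<close> virtual crossings, \<open>Pass e k\<close> being its \<open>k\<close>-th passage, and
  \<open>meetings A\<close> records which two passages take place at the same virtual crossing. Every choice of
  arcs in the plane gives such data.
\<close>

datatype virtual_point = VLoop nat | End nat | Pass nat nat

record outer_arcs =
  passages :: "nat \<Rightarrow> nat"
  meetings :: "virtual_point set set"

definition pass_points :: "'c tangle \<Rightarrow> outer_arcs \<Rightarrow> virtual_point set" where
  "pass_points L A = {Pass e k |e k. e \<in> endpoints L - entering L \<and> k < passages A e}"

definition drawn_outside :: "'c tangle \<Rightarrow> outer_arcs \<Rightarrow> bool" where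
  "drawn_outside L A \<longleftrightarrow>
     partition_on (pass_points L A) (meetings A) \<and> (\<forall>w \<in> meetings A. card w = 2)"

fun pi_next :: "'c tangle \<Rightarrow> outer_arcs \<Rightarrow> ('c, virtual_point) vertex \<Rightarrow> ('c, virtual_point) vertex" where
  "pi_next L A (Corner c k) = map_vertex id End (arc L (Corner c k))"
| "pi_next L A (Point (End e)) =
     (if e \<in> entering L then map_vertex id End (arc L (Point e))
      else if 0 < passages A e then Point (Pass e 0) else Point (End (antipode L e)))"
| "pi_next L A (Point (Pass e k)) =
     (if Suc k < passages A e then Point (Pass e (Suc k)) else Point (End (antipode L e)))"
| "pi_next L A (Point (VLoop j)) = Point (VLoop j)"

definition pi_diagram :: "'c tangle \<Rightarrow> outer_arcs \<Rightarrow> ('c, virtual_point) virtual_diagram" where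
  "pi_diagram L A =
     \<lparr>crossings = tcrossings L, positive = tpositive L,
      points = VLoop ` {..<loops L} \<union> End ` endpoints L \<union> pass_points L A,
      next = pi_next L A, vcrossings = meetings A\<rparr>"


section \<open>States and their circles\<close>

text \<open>
  A state is identified with the set of its B-smoothed crossings. The A-smoothing joins the two
  regions swept out when the overstrand is turned counterclockwise; at a positive crossing these are
  the top and the bottom region, so the A-smoothing is the vertical one.
\<close>

definition vertical :: "('c, 'p, 'z) diagram_scheme \<Rightarrow> 'c set \<Rightarrow> 'c \<Rightarrow> bool" where
  "vertical D S c \<longleftrightarrow> (positive D c \<longleftrightarrow> c \<notin> S)"

text \<open>
  The two arcs of the vertical (\<open>True\<close>) or horizontal (\<open>False\<close>) smoothing with their local
  orientations, as (start, end). The left arc precedes the right one, the top arc the bottom one.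
\<close>

definition site_arcs :: "bool \<Rightarrow> (corner \<times> corner) list" where
  "site_arcs v = (if v then [(SW, NW), (NE, SE)] else [(NE, NW), (SW, SE)])"

definition partner :: "bool \<Rightarrow> corner \<Rightarrow> corner" where
  "partner v k = (THE l. (k, l) \<in> set (site_arcs v) \<or> (l, k) \<in> set (site_arcs v))"

text \<open>
  Positions on a state: \<open>At (Corner c k)\<close> lies on the half-edge \<open>k\<close> of \<open>c\<close> next to the
  crossing, \<open>Mid u\<close> is the middle of the edge with tail \<open>u\<close>. A position with a direction of travel is
  a pair whose second component tells whether one travels along the orientation of the diagram.
\<close>

datatype ('c, 'p) position = At "('c, 'p) vertex" | Mid "('c, 'p) vertex"

definition positions :: "('c, 'p, 'z) diagram_scheme \<Rightarrow> ('c, 'p) position set" where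
  "positions D = At ` (tails D \<union> heads D) \<union> Mid ` tails D"

text \<open>
  Travelling along a circle of the state \<open>S\<close>; at a corner one travels into the crossing iff the
  direction equals \<open>incoming\<close>.
\<close>

fun step :: "('c, 'p, 'z) diagram_scheme \<Rightarrow> 'c set \<Rightarrow>
    ('c, 'p) position \<times> bool \<Rightarrow> ('c, 'p) position \<times> bool" where
  "step D S (Mid u, d) = (At (if d then next D u else u), d)"
| "step D S (At (Point p), d) = (Mid (if d then Point p else prev D (Point p)), d)"
| "step D S (At (Corner c k), d) =
     (if d = incoming k
      then (let l = partner (vertical D S c) k in (At (Corner c l), \<not> incoming l))
      else (Mid (if d then Corner c k else prev D (Corner c k)), d))"

definition oriented_circle :: "('c, 'p, 'z) diagram_scheme \<Rightarrow> 'c set \<Rightarrow>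
    ('c, 'p) position \<times> bool \<Rightarrow> (('c, 'p) position \<times> bool) set" where
  "oriented_circle D S y = orbit (step D S) y"

definition circle :: "('c, 'p, 'z) diagram_scheme \<Rightarrow> 'c set \<Rightarrow> ('c, 'p) position \<Rightarrow>
    ('c, 'p) position set" where
  "circle D S x = fst ` oriented_circle D S (x, True)"


section \<open>The algebra and the common part of the edge maps\<close>

text \<open>\<open>V\<close> is described by its basis; the following are matrix entries of the structure maps.\<close>

datatype label = One | X

fun mult_coeff :: "label \<Rightarrow> label \<Rightarrow> label \<Rightarrow> rat" where
  "mult_coeff One a b = (if b = a then 1 else 0)"
| "mult_coeff X One b = (if b = X then 1 else 0)"
| "mult_coeff X X b = 0"

fun comult_coeff :: "label \<Rightarrow> label \<times> label \<Rightarrow> rat" where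
  "comult_coeff One p = (if p = (One, X) \<or> p = (X, One) then 1 else 0)"
| "comult_coeff X p = (if p = (X, X) then 1 else 0)"

text \<open>The diagonal entry at \<open>a\<close> of the bar involution (if \<open>b\<close>) or of the identity (if not \<open>b\<close>).\<close>

definition bar_if :: "bool \<Rightarrow> label \<Rightarrow> rat" where
  "bar_if b a = (if b \<and> a = X then - 1 else 1)"

text \<open>The numbered circles of a state form a list \<open>K\<close> of sets of positions.\<close>

definition index_of :: "('c, 'p) position set list \<Rightarrow> ('c, 'p) position \<Rightarrow> nat" where
  "index_of K x = (THE i. i < length K \<and> x \<in> K ! i)"

definition involved :: "('c, 'p) position set list \<Rightarrow> 'c \<Rightarrow> bool \<Rightarrow> nat list" where
  "involved K c v = remdups (map (\<lambda>(k, l). index_of K (At (Corner c k))) (site_arcs v))"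

definition uninvolved :: "('c, 'p) position set list \<Rightarrow> 'c \<Rightarrow> bool \<Rightarrow> nat list" where
  "uninvolved K c v = filter (\<lambda>p. p \<notin> set (involved K c v)) [0..<length K]"

definition counterpart :: "('c, 'p) position set list \<Rightarrow> ('c, 'p) position set list \<Rightarrow> nat \<Rightarrow> nat" where
  "counterpart K K' p = (THE q. q < length K' \<and> K' ! q = K ! p)"

definition list_sign :: "nat list \<Rightarrow> int" where
  "list_sign l = sign (\<lambda>i. if i < length l then l ! i else i)"

text \<open>
  The matrix entry, from the labels \<open>w\<close> on \<open>K\<close> to the labels \<open>w'\<close> on \<open>K'\<close>, of the map on the edge
  that changes the smoothing of \<open>c\<close> from \<open>v\<close> to \<open>\<not> v\<close>. The elements on the involved circles are
  barred before and after the bifurcation as told by \<open>f\<close> and \<open>f'\<close>, those on uninvolved circles as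
  told by \<open>g\<close>. In the permutation rule the uninvolved circles have the same relative order in
  source and target (that of the source numbering; any common order gives the same sign).
\<close>

definition edge_coeff :: "('c, 'p) position set list \<Rightarrow> ('c, 'p) position set list \<Rightarrow> 'c \<Rightarrow> bool \<Rightarrow>
    (nat \<Rightarrow> bool) \<Rightarrow> (nat \<Rightarrow> bool) \<Rightarrow> (nat \<Rightarrow> nat \<Rightarrow> bool) \<Rightarrow> label list \<Rightarrow> label list \<Rightarrow> rat" where
  "edge_coeff K K' c v f f' g w w' =
     (let I = involved K c v; I' = involved K' c (\<not> v);
          R = uninvolved K c v; R' = map (counterpart K K') R
      in of_int (list_sign (I @ R) * list_sign (I' @ R'))
         * (\<Prod>i\<in>set I. bar_if (f i) (w ! i))
         * (case (I, I') of
              ([i, j], [k]) \<Rightarrow> mult_coeff (w ! i) (w ! j) (w' ! k)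
            | ([i], [k, l]) \<Rightarrow> comult_coeff (w ! i) (w' ! k, w' ! l)
            | _ \<Rightarrow> 0)
         * (\<Prod>k\<in>set I'. bar_if (f' k) (w' ! k))
         * (\<Prod>p\<in>set R. let q = counterpart K K' p in
              if w ! p = w' ! q then bar_if (g p q) (w ! p) else 0))"


section \<open>Cochain complexes and cohomology\<close>

text \<open>
  Cochains are rational combinations of generators, written as functions. A generator is a state
  with a label on each of its circles; its degree is the number of B-smoothings.
\<close>

type_synonym 'c cochain = "'c set \<times> label list \<Rightarrow> rat"

record 'c cochain_complex =
  cochains :: "nat \<Rightarrow> 'c cochain set"
  differential :: "'c cochain \<Rightarrow> 'c cochain"

text \<open>\<open>n S\<close> is the number of circles of \<open>S\<close>; \<open>E S c\<close> is the matrix of the edge from \<open>S\<close> to \<open>insert c S\<close>.\<close>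

definition cube_complex :: "'c set \<Rightarrow> ('c set \<Rightarrow> nat) \<Rightarrow>
    ('c set \<Rightarrow> 'c \<Rightarrow> label list \<Rightarrow> label list \<Rightarrow> rat) \<Rightarrow> 'c cochain_complex" where
  "cube_complex C n E =
     \<lparr>cochains = (\<lambda>r. {f. \<forall>S w. f (S, w) \<noteq> 0 \<longrightarrow> S \<subseteq> C \<and> card S = r \<and> length w = n S}),
      differential = (\<lambda>f (T, v).
        if T \<subseteq> C \<and> length v = n T
        then \<Sum>c\<in>T. \<Sum>w | length w = n (T - {c}). E (T - {c}) c w v * f (T - {c}, w)
        else 0)\<rparr>"

text \<open>
  As the differential squares to zero, the coboundaries are a subgroup of the cocycles; the
  quotient is HOL-Algebra's group of cosets.
\<close>

definition cocycles :: "'c cochain_complex \<Rightarrow> nat \<Rightarrow> 'c cochain set" where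
  "cocycles K r = {f \<in> cochains K r. differential K f = (\<lambda>_. 0)}"

definition coboundaries :: "'c cochain_complex \<Rightarrow> nat \<Rightarrow> 'c cochain set" where
  "coboundaries K r = (if r = 0 then {\<lambda>_. 0} else differential K ` cochains K (r - 1))"

definition cohomology :: "'c cochain_complex \<Rightarrow> nat \<Rightarrow> 'c cochain set monoid" where
  "cohomology K r =
     \<lparr>carrier = cocycles K r, monoid.mult = (\<lambda>f g x. f x + g x), monoid.one = (\<lambda>_. 0)\<rparr> Mod coboundaries K r"

definition chain_map :: "'c cochain_complex \<Rightarrow> 'c cochain_complex \<Rightarrow>
    ('c cochain \<Rightarrow> 'c cochain) \<Rightarrow> bool" where
  "chain_map K K' h \<longleftrightarrow>
     (\<forall>r. \<forall>f \<in> cochains K r.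
        h f \<in> cochains K' r \<and>
        (\<forall>g \<in> cochains K r. h (\<lambda>x. f x + g x) = (\<lambda>x. h f x + h g x)) \<and>
        (\<forall>a. h (\<lambda>x. a * f x) = (\<lambda>x. a * h f x)) \<and>
        h (differential K f) = differential K' (h f))"

text \<open>The map sending the cohomology class of \<open>z\<close> to that of \<open>h z\<close>.\<close>

definition induced :: "'c cochain_complex \<Rightarrow> ('c cochain \<Rightarrow> 'c cochain) \<Rightarrow> nat \<Rightarrow>
    'c cochain set \<Rightarrow> 'c cochain set" where
  "induced K' h r Z = {\<lambda>x. b x + h z x |b z. b \<in> coboundaries K' r \<and> z \<in> Z}"


section \<open>The Dye--Kaestner--Kauffman complex\<close>

text \<open>
  Source-sink orientation: into the crossing at SW and NE, out of it at SE and NW. A half-edge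
  carries a cut point iff this disagrees with the orientation of the diagram.
\<close>

definition source_sink_in :: "corner \<Rightarrow> bool" where
  "source_sink_in k \<longleftrightarrow> k = SW \<or> k = NE"

definition has_cut :: "corner \<Rightarrow> bool" where
  "has_cut k \<longleftrightarrow> source_sink_in k \<noteq> incoming k"

text \<open>
  The local orientation at a position: the source-sink orientation between a crossing and the
  adjacent cut points, the orientation of the diagram beyond them.
\<close>

fun local_dir :: "('c, 'p) position \<Rightarrow> bool" where
  "local_dir (At (Corner c k)) = (source_sink_in k = incoming k)"
| "local_dir (At (Point p)) = True"
| "local_dir (Mid u) = True"

text \<open>The cut point of a half-edge lies between the corner and the middle of the edge.\<close>

definition passes_cut :: "('c, 'p) position \<Rightarrow> ('c, 'p) position \<Rightarrow> bool" where
  "passes_cut x y \<longleftrightarrow>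
     (\<exists>c k u. has_cut k \<and> {x, y} = {At (Corner c k), Mid u})"

text \<open>
  Whether an odd number of cut points is met when travelling from \<open>y\<close> until the first position
  in \<open>T\<close>.
\<close>

definition odd_cuts :: "('c, 'p, 'z) diagram_scheme \<Rightarrow> 'c set \<Rightarrow>
    ('c, 'p) position \<times> bool \<Rightarrow> ('c, 'p) position set \<Rightarrow> bool" where
  "odd_cuts D S y T =
     (let n = LEAST n. fst ((step D S ^^ n) y) \<in> T
      in odd (card {i. i < n \<and> passes_cut (fst ((step D S ^^ i) y)) (fst ((step D S ^^ Suc i) y))}))"

definition site :: "'c \<Rightarrow> ('c, 'p) position set" where
  "site c = {At (Corner c k) |k. True}"

text \<open>
  A choice, for each state, of a base point on each circle; listing the base points also numbers
  the circles.
\<close>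

definition base_points :: "('c, 'p, 'z) diagram_scheme \<Rightarrow>
    ('c set \<Rightarrow> ('c, 'p) position list) \<Rightarrow> bool" where
  "base_points D bp \<longleftrightarrow>
     (\<forall>S \<subseteq> crossings D. set (bp S) \<subseteq> positions D \<and>
        (\<forall>x \<in> positions D. \<exists>!i. i < length (bp S) \<and> bp S ! i \<in> circle D S x))"

text \<open>
  After the bifurcation the elements travel from the site to the base point along the global
  orientation; the cut points met are those between the base point and the site when travelling
  backwards from the base point.
\<close>

definition DKK_edge :: "('c, 'p, 'z) diagram_scheme \<Rightarrow> ('c set \<Rightarrow> ('c, 'p) position list) \<Rightarrow>
    'c set \<Rightarrow> 'c \<Rightarrow> label list \<Rightarrow> label list \<Rightarrow> rat" where
  "DKK_edge D bp S c =
     (let T = insert c S in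
      edge_coeff (map (circle D S) (bp S)) (map (circle D T) (bp T)) c (vertical D S c)
        (\<lambda>i. odd_cuts D S (bp S ! i, local_dir (bp S ! i)) (site c))
        (\<lambda>k. odd_cuts D T (bp T ! k, \<not> local_dir (bp T ! k)) (site c))
        (\<lambda>p q. odd_cuts D S (bp S ! p, local_dir (bp S ! p)) {bp T ! q}))"

definition DKK_complex :: "('c, 'p) virtual_diagram \<Rightarrow> ('c set \<Rightarrow> ('c, 'p) position list) \<Rightarrow>
    'c cochain_complex" where
  "DKK_complex D bp = cube_complex (crossings D) (\<lambda>S. length (bp S)) (DKK_edge D bp)"


section \<open>The unlabeled Manolescu--Willis complex\<close>

text \<open>A numbering and global orientations: for each state a list of its circles, oriented.\<close>

definition oriented_numbering :: "('c, 'p, 'z) diagram_scheme \<Rightarrow>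
    ('c set \<Rightarrow> (('c, 'p) position \<times> bool) set list) \<Rightarrow> bool" where
  "oriented_numbering D oc \<longleftrightarrow>
     (\<forall>S \<subseteq> crossings D.
        (\<forall>Q \<in> set (oc S). \<exists>x \<in> positions D. \<exists>d. Q = oriented_circle D S (x, d)) \<and>
        (\<forall>x \<in> positions D. \<exists>!i. i < length (oc S) \<and> x \<in> fst ` (oc S ! i)))"

text \<open>
  The oriented circle \<open>Q\<close> passes through an arc of the smoothing \<open>v\<close> of \<open>c\<close> against the local
  orientation of the arc, i.e. it does not enter the crossing at the start of the arc. If \<open>Q\<close>
  contains both arcs, \<open>X\<close> is replaced by \<open>- X\<close> only once (for merges and splits the
  two arcs then agree or disagree simultaneously).
\<close>

definition disagrees :: "(('c, 'p) position \<times> bool) set \<Rightarrow> 'c \<Rightarrow> bool \<Rightarrow> bool" where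
  "disagrees Q c v \<longleftrightarrow>
     (\<exists>(k, l) \<in> set (site_arcs v).
        At (Corner c k) \<in> fst ` Q \<and> (At (Corner c k), incoming k) \<notin> Q)"

definition MW_edge :: "('c, 'p, 'z) diagram_scheme \<Rightarrow>
    ('c set \<Rightarrow> (('c, 'p) position \<times> bool) set list) \<Rightarrow>
    'c set \<Rightarrow> 'c \<Rightarrow> label list \<Rightarrow> label list \<Rightarrow> rat" where
  "MW_edge D oc S c =
     (let T = insert c S; v = vertical D S c in
      edge_coeff (map ((`) fst) (oc S)) (map ((`) fst) (oc T)) c v
        (\<lambda>i. disagrees (oc S ! i) c v)
        (\<lambda>k. disagrees (oc T ! k) c (\<not> v))
        (\<lambda>p q. oc S ! p \<noteq> oc T ! q))"

definition MW_complex :: "'c tangle \<Rightarrow>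
    ('c set \<Rightarrow> (('c, rp2_point) position \<times> bool) set list) \<Rightarrow> 'c cochain_complex" where
  "MW_complex L oc =
     cube_complex (tcrossings L) (\<lambda>S. length (oc S)) (MW_edge (rp2_diagram L) oc)"


section \<open>The map \<open>\<alpha>\<close>\<close>

text \<open>
  The crossings of \<open>L\<close> are the classical crossings of \<open>\<pi>(L)\<close>, and \<open>\<pi>(s)\<close> is the state of
  \<open>\<pi>(L)\<close> with the same smoothings as \<open>s\<close>.
\<close>

definition pi_state :: "'c set \<Rightarrow> 'c set" where
  "pi_state S = S"

text \<open>
  The circle of \<open>s\<close> corresponding to a circle of \<open>\<pi>(s)\<close> is its image under the map that collapses
  each outer arc to the corresponding boundary point of the projective plane.
\<close>

fun collapse_vertex :: "'c tangle \<Rightarrow> ('c, virtual_point) vertex \<Rightarrow> ('c, rp2_point) vertex" where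
  "collapse_vertex L (Corner c k) = Corner c k"
| "collapse_vertex L (Point (VLoop j)) = Point (Loop j)"
| "collapse_vertex L (Point (End e)) = Point (Bdry (e mod pairs L))"
| "collapse_vertex L (Point (Pass e k)) = Point (Bdry (e mod pairs L))"

definition outer_tail :: "'c tangle \<Rightarrow> ('c, virtual_point) vertex \<Rightarrow> bool" where
  "outer_tail L u \<longleftrightarrow> (\<exists>e. u = Point (End e) \<and> e \<notin> entering L) \<or> (\<exists>e k. u = Point (Pass e k))"

fun collapse :: "'c tangle \<Rightarrow> ('c, virtual_point) position \<Rightarrow> ('c, rp2_point) position" where
  "collapse L (At v) = At (collapse_vertex L v)"
| "collapse L (Mid u) =
     (if outer_tail L u then At (collapse_vertex L u) else Mid (collapse_vertex L u))"

text \<open>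
  Circles of \<open>s\<close> and \<open>\<pi>(s)\<close> have the same numbers, and the global orientation of each circle of \<open>s\<close>
  is the local orientation at the base point of the corresponding circle of \<open>\<pi>(s)\<close>.
\<close>

definition corresponding :: "'c tangle \<Rightarrow> outer_arcs \<Rightarrow>
    ('c set \<Rightarrow> ('c, virtual_point) position list) \<Rightarrow>
    ('c set \<Rightarrow> (('c, rp2_point) position \<times> bool) set list) \<Rightarrow> bool" where
  "corresponding L A bp oc \<longleftrightarrow>
     (\<forall>S \<subseteq> tcrossings L.
        oc S = map (\<lambda>b. map_prod (collapse L) id `
                          oriented_circle (pi_diagram L A) (pi_state S) (b, local_dir b))
                   (bp (pi_state S)))"

definition alpha :: "'c tangle \<Rightarrow> ('c set \<Rightarrow> nat) \<Rightarrow> 'c cochain \<Rightarrow> 'c cochain" where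
  "alpha L n f = (\<lambda>g. \<Sum>(S, w) | S \<subseteq> tcrossings L \<and> length w = n S.
     if g = (pi_state S, w) then f (S, w) else 0)"

end

theory Submission
  imports Defs
begin

text \<open>
  Collapsing the outer arcs identifies the circles of \<open>\<pi>(s)\<close> with those of \<open>s\<close>, and under this
  identification the two complexes coincide, so that \<open>\<alpha>\<close> is the identity. What has to be compared
  are the signs of corresponding edge maps. Travelling along a circle, the direction of travel
  changes between agreeing and disagreeing with the local orientation exactly at the cut points:
  passing through a smoothed crossing preserves agreement, because both smoothings lead from a
  source-sink inward half-edge to an outward one. Hence the parity of the cut points between the base
  point and the site tells whether the global orientation disagrees with the local one at the
  first arc reached (nearby rule), and the parity between old and new base point of an uninvolved
  circle tells whether its two global orientations differ (far rule). The arc reached first does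
  not matter, since in a merge or a split the two arcs on a common circle agree or disagree
  simultaneously.
\<close>


section \<open>Orbits of reversible maps\<close>

text \<open>\<open>f\<close> is one step of travel and \<open>r\<close> turns around.
  \<open>map_rev_map\<close> says that a step can be retraced; \<open>rev_neq\<close> and
  \<open>map_neq_rev\<close> exclude the two shortest walks that return to their start in the
  opposite direction.\<close>

locale reversible_map =
  fixes P :: "'a set" and f r :: "'a \<Rightarrow> 'a"
  assumes finite_domain: "finite P"
    and map_closed: "x \<in> P \<Longrightarrow> f x \<in> P"
    and rev_closed: "x \<in> P \<Longrightarrow> r x \<in> P"
    and rev_rev: "r (r x) = x"
    and rev_neq: "r x \<noteq> x"
    and map_rev_map: "x \<in> P \<Longrightarrow> f (r (f x)) = r x"
    and map_neq_rev: "x \<in> P \<Longrightarrow> f x \<noteq> r x"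
begin

lemma inj_on_map: "inj_on f P"
  by (metis inj_onI map_rev_map rev_rev)

lemma map_permutes: "(\<lambda>x. if x \<in> P then f x else x) permutes P"
proof (rule bij_imp_permutes)
  have "f ` P = P"
    using endo_inj_surj[OF finite_domain _ inj_on_map] map_closed by blast
  then have "bij_betw f P P"
    using inj_on_map by (simp add: bij_betw_def)
  then show "bij_betw (\<lambda>x. if x \<in> P then f x else x) P P"
    by (simp cong: bij_betw_cong)
qed simp

text \<open>The inductive \<open>orbit f x\<close> begins at \<open>f x\<close>, so this is a
  statement of periodicity. It holds because \<open>f\<close>, extended by the identity outside the
  finite set \<open>P\<close>, is a permutation.\<close>

lemma self_in_orbit: "x \<in> P \<Longrightarrow> x \<in> orbit f x"
proof -
  assume x: "x \<in> P"
  let ?g = "\<lambda>x. if x \<in> P then f x else x"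
  have "permutation ?g"
    using map_permutes finite_domain permutation_permutes by blast
  then have "x \<in> orbit ?g x"
    by (rule permutation_self_in_orbit)
  also have "orbit ?g x = orbit f x"
    using x map_closed by (intro orbit_cong0[where A = P]) auto
  finally show ?thesis .
qed

lemma orbit_closed: "y \<in> orbit f x \<Longrightarrow> x \<in> P \<Longrightarrow> y \<in> P"
  by (induction rule: orbit.induct) (auto intro: map_closed)

lemma orbit_symmetric: "y \<in> orbit f x \<Longrightarrow> x \<in> P \<Longrightarrow> x \<in> orbit f y"
  using orbit_swap[OF self_in_orbit] .

lemma orbit_eq: "y \<in> orbit f x \<Longrightarrow> x \<in> P \<Longrightarrow> orbit f y = orbit f x"
  by (meson orbit_symmetric orbit_trans subset_antisym subsetI)

lemma same_orbit: "y \<in> orbit f x \<Longrightarrow> z \<in> orbit f x \<Longrightarrow> x \<in> P \<Longrightarrow> z \<in> orbit f y"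
  by (simp add: orbit_eq)

lemma funpow_in_orbit: "x \<in> P \<Longrightarrow> (f ^^ n) x \<in> orbit f x"
  by (simp add: Orbits.funpow_in_orbit self_in_orbit)

lemma orbit_eq_funpow: "x \<in> P \<Longrightarrow> orbit f x = {(f ^^ n) x | n. True}"
  by (simp add: orbit_altdef_self_in self_in_orbit)

text \<open>\<open>r\<close> turns a step forwards into a step backwards, and on a finite orbit
  whatever is reached backwards is also reached forwards (\<open>orbit_symmetric\<close>).\<close>

lemma rev_in_orbit:
  assumes "y \<in> orbit f x" "x \<in> P"
  shows "r y \<in> orbit f (r x)"
  using assms
proof (induction rule: orbit.induct)
  case base
  then show ?case
    by (metis map_closed map_rev_map orbit.base orbit_symmetric rev_closed)
next
  case (step y)
  then have y: "y \<in> P"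
    using orbit_closed by blast
  then have "r y \<in> orbit f (r (f y))"
    by (metis map_rev_map orbit.base)
  then have "r (f y) \<in> orbit f (r y)"
    using y by (simp add: map_closed orbit_symmetric rev_closed)
  then show ?case
    using step orbit_trans by metis
qed

text \<open>A walk that returns to its start reversed must fold in its middle: removing the first
  and the last step leaves a shorter such walk from \<open>f x\<close>, until length 0 or 1
  contradicts \<open>rev_neq\<close> or \<open>map_neq_rev\<close>.\<close>

lemma funpow_neq_rev: "x \<in> P \<Longrightarrow> (f ^^ n) x \<noteq> r x"
proof (induction n arbitrary: x rule: less_induct)
  case (less n)
  consider "n = 0" | "n = 1" | m where "n = Suc (Suc m)"
    by (metis One_nat_def not0_implies_Suc)
  then show ?case
  proof cases
    case 1
    then show ?thesis using rev_neq[of x] by auto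
  next
    case 2
    then show ?thesis using map_neq_rev less.prems by simp
  next
    case (3 m)
    let ?y = "f x"
    have y: "?y \<in> P" using less.prems map_closed by blast
    have my: "(f ^^ m) ?y \<in> P"
      using funpow_in_orbit orbit_closed y by blast
    show ?thesis
    proof
      assume "(f ^^ n) x = r x"
      moreover have "(f ^^ n) x = f ((f ^^ m) ?y)"
        using 3 by (simp add: funpow_swap1)
      \<comment> \<open>Both sides equal \<open>r x\<close>, the right one by
        \<open>map_rev_map\<close>; injectivity then cancels the last step.\<close>
      ultimately have "f ((f ^^ m) ?y) = f (r ?y)"
        using map_rev_map less.prems by simp
      then have "(f ^^ m) ?y = r ?y"
        using inj_on_map my y rev_closed by (meson inj_onD)
      then show False
        using less.IH[of m ?y] 3 y by simp
    qed
  qed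
qed

lemma rev_notin_orbit: "x \<in> P \<Longrightarrow> r x \<notin> orbit f x"
  by (auto simp: orbit_eq_funpow) (metis funpow_neq_rev)

end


section \<open>Travelling on the states of a closed diagram\<close>

lemma partner_eq:
  "partner v k =
     (if v then (case k of SW \<Rightarrow> NW | NW \<Rightarrow> SW | NE \<Rightarrow> SE | SE \<Rightarrow> NE)
      else (case k of SW \<Rightarrow> SE | SE \<Rightarrow> SW | NE \<Rightarrow> NW | NW \<Rightarrow> NE))"
  unfolding partner_def site_arcs_def
  by (rule the_equality) (auto split: corner.splits if_splits)

lemma partner_partner [simp]: "partner v (partner v k) = k"
  by (auto simp: partner_eq split: corner.splits)

lemma partner_neq [simp]: "partner v k \<noteq> k"
  by (auto simp: partner_eq split: corner.splits)

lemma source_sink_in_partner [simp]: "source_sink_in (partner v k) \<longleftrightarrow> \<not> source_sink_in k"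
  by (auto simp: partner_eq source_sink_in_def split: corner.splits)

lemma UNIV_corner: "(UNIV :: corner set) = {SW, SE, NE, NW}"
  by (auto intro: corner.exhaust)

lemma finite_corner [simp]: "finite (A :: corner set)"
  by (rule finite_subset[OF subset_UNIV]) (simp add: UNIV_corner)

text \<open>The local orientations of the smoothing arcs are the source-sink ones: whichever the
  smoothing, an arc runs from an inward half-edge, \<open>SW\<close> or \<open>NE\<close>, to an
  outward one.\<close>

lemma site_arcs_iff: "(k, l) \<in> set (site_arcs v) \<longleftrightarrow> source_sink_in k \<and> l = partner v k"
  by (cases k; cases l) (auto simp: site_arcs_def source_sink_in_def partner_eq)

abbreviation flip :: "'a \<times> bool \<Rightarrow> 'a \<times> bool" where
  "flip \<equiv> apsnd Not"

definition agrees :: "('c, 'p) position \<times> bool \<Rightarrow> bool" where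
  "agrees y \<longleftrightarrow> snd y = local_dir (fst y)"

lemma agrees_flip [simp]: "agrees (flip y) \<longleftrightarrow> \<not> agrees y"
  by (cases y) (auto simp: agrees_def)

text \<open>The places from which the next step follows a smoothing arc of \<open>c\<close>, hence
  the only ones where \<open>step\<close> consults the smoothing of \<open>c\<close>.\<close>

fun entering_site :: "'c \<Rightarrow> ('c, 'p) position \<times> bool \<Rightarrow> bool" where
  "entering_site c (At (Corner c' k), d) \<longleftrightarrow> c' = c \<and> d = incoming k"
| "entering_site c _ \<longleftrightarrow> False"

locale closed_diagram =
  fixes D :: "('c, 'p, 'z) diagram_scheme"
  assumes finite_crossings: "finite (crossings D)"
    and finite_points: "finite (points D)"
    and bij_next: "bij_betw (next D) (tails D) (heads D)"
begin

lemma prev_next: "u \<in> tails D \<Longrightarrow> prev D (next D u) = u"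
  using bij_next by (simp add: prev_def bij_betw_def)

lemma next_prev: "v \<in> heads D \<Longrightarrow> next D (prev D v) = v"
  using bij_next by (simp add: prev_def bij_betw_def f_inv_into_f)

lemma next_in_heads: "u \<in> tails D \<Longrightarrow> next D u \<in> heads D"
  using bij_next by (auto simp: bij_betw_def)

lemma prev_in_tails: "v \<in> heads D \<Longrightarrow> prev D v \<in> tails D"
  using bij_next by (auto simp: bij_betw_def prev_def intro: inv_into_into)

lemma corner_in_tails [simp]: "Corner c k \<in> tails D \<longleftrightarrow> c \<in> crossings D \<and> \<not> incoming k"
  by (auto simp: tails_def)

lemma corner_in_heads [simp]: "Corner c k \<in> heads D \<longleftrightarrow> c \<in> crossings D \<and> incoming k"
  by (auto simp: heads_def)

lemma point_in_tails [simp]: "Point p \<in> tails D \<longleftrightarrow> p \<in> points D"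
  by (auto simp: tails_def)

lemma point_in_heads [simp]: "Point p \<in> heads D \<longleftrightarrow> p \<in> points D"
  by (auto simp: heads_def)

lemma corner_in_positions [simp]: "At (Corner c k) \<in> positions D \<longleftrightarrow> c \<in> crossings D"
  by (auto simp: positions_def)

lemma point_in_positions [simp]: "At (Point p) \<in> positions D \<longleftrightarrow> p \<in> points D"
  by (auto simp: positions_def)

lemma mid_in_positions [simp]: "Mid u \<in> positions D \<longleftrightarrow> u \<in> tails D"
  by (auto simp: positions_def)

lemma head_in_positions: "v \<in> heads D \<Longrightarrow> At v \<in> positions D"
  and tail_in_positions: "v \<in> tails D \<Longrightarrow> At v \<in> positions D"
  by (auto simp: positions_def)

lemma finite_positions: "finite (positions D)"
proof -
  have "tails D \<union> heads D \<subseteq> (\<lambda>(c, k). Corner c k) ` (crossings D \<times> UNIV) \<union> Point ` points D"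
    by (auto simp: tails_def heads_def)
  then have "finite (tails D \<union> heads D)"
    using finite_crossings finite_points by (auto intro: finite_subset)
  then show ?thesis
    by (simp add: positions_def)
qed

lemma position_cases:
  assumes "x \<in> positions D"
  obtains u where "x = Mid u" "u \<in> tails D"
  | p where "x = At (Point p)" "p \<in> points D"
  | c k where "x = At (Corner c k)" "c \<in> crossings D"
  using assms by (auto simp: positions_def tails_def heads_def)

lemma step_in_positions:
  assumes "x \<in> positions D"
  shows "fst (step D S (x, d)) \<in> positions D"
  using assms
  by (cases rule: position_cases)
    (auto simp: Let_def next_in_heads head_in_positions tail_in_positions intro!: prev_in_tails)

text \<open>Along edges \<open>next\<close> and \<open>prev\<close> undo each other; at a crossing
  \<open>partner\<close> is an involution.\<close>

lemma flip_step_flip_step: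
  assumes "x \<in> positions D"
  shows "step D S (flip (step D S (x, d))) = flip (x, d)"
  using assms
proof (cases rule: position_cases)
  case (1 u)
  show ?thesis
  proof (cases d)
    case True
    have "next D u \<in> heads D"
      using 1 next_in_heads by blast
    then show ?thesis
      using 1 True prev_next[of u] by (cases "next D u") auto
  next
    case False
    then show ?thesis
      using 1 by (cases u) auto
  qed
qed (auto simp: Let_def next_prev)

text \<open>Every step changes the position, at a crossing because no corner is its own
  partner.\<close>

lemma step_neq_flip: "step D S (x, d) \<noteq> flip (x, d)"
  by (cases "(D, S, (x, d))" rule: step.cases) (auto simp: Let_def dest: partner_neq[THEN notE])

sublocale reversible_map "positions D \<times> UNIV" "step D S" flip for S
proof
  fix y :: "('c, 'p) position \<times> bool"
  assume "y \<in> positions D \<times> UNIV"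
  then obtain x d where y: "y = (x, d)" "x \<in> positions D"
    by auto
  show "step D S y \<in> positions D \<times> UNIV"
    using y step_in_positions[of x S d] by (auto simp: mem_Times_iff)
  show "step D S (flip (step D S y)) = flip y"
    unfolding y(1) by (rule flip_step_flip_step[OF y(2)])
  show "step D S y \<noteq> flip y"
    unfolding y(1) by (rule step_neq_flip)
qed (auto simp: finite_positions prod_eq_iff)

text \<open>Travelling the other way visits the same positions (\<open>rev_in_orbit\<close>), so the
  \<open>True\<close> in the definition of \<open>circle\<close> is a mere convention.\<close>

lemma circle_eq:
  assumes "x \<in> positions D"
  shows "circle D S x = fst ` orbit (step D S) (x, d)"
proof -
  have sub: "fst ` orbit (step D S) (x, a) \<subseteq> fst ` orbit (step D S) (x, \<not> a)" for a
  proof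
    fix y assume "y \<in> fst ` orbit (step D S) (x, a)"
    then obtain b where "(y, b) \<in> orbit (step D S) (x, a)"
      by auto
    then have "flip (y, b) \<in> orbit (step D S) (flip (x, a))"
      using assms by (intro rev_in_orbit) auto
    then show "y \<in> fst ` orbit (step D S) (x, \<not> a)"
      by force
  qed
  have "fst ` orbit (step D S) (x, True) = fst ` orbit (step D S) (x, False)"
    using sub[of True] sub[of False] by auto
  then show ?thesis
    by (cases d) (simp_all add: circle_def oriented_circle_def)
qed

lemma circle_refl: "x \<in> positions D \<Longrightarrow> x \<in> circle D S x"
  unfolding circle_def oriented_circle_def
  using self_in_orbit[of "(x, True)" S] by force

lemma circle_subset: "x \<in> positions D \<Longrightarrow> circle D S x \<subseteq> positions D"
  unfolding circle_def oriented_circle_def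
  using orbit_closed[of _ S "(x, True)"] by fastforce

lemma circle_eq_circle:
  assumes "x \<in> positions D" "y \<in> circle D S x"
  shows "circle D S y = circle D S x"
proof -
  obtain d where d: "(y, d) \<in> orbit (step D S) (x, True)"
    using assms(2) by (auto simp: circle_def oriented_circle_def)
  have "y \<in> positions D"
    using circle_subset assms by blast
  then have "circle D S y = fst ` orbit (step D S) (y, d)"
    by (rule circle_eq)
  also have "\<dots> = circle D S x"
    using orbit_eq[OF d] assms(1) by (simp add: circle_def oriented_circle_def)
  finally show ?thesis .
qed

text \<open>A position visited in both directions would put the reversal of a point into its own
  orbit.\<close>

lemma orbit_direction_unique:
  assumes "(x, d) \<in> orbit (step D S) y" "(x, d') \<in> orbit (step D S) y" "y \<in> positions D \<times> UNIV"
  shows "d' = d"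
proof (rule ccontr)
  assume "d' \<noteq> d"
  then have "(x, d') = flip (x, d)"
    by auto
  moreover have "orbit (step D S) y = orbit (step D S) (x, d)" "(x, d) \<in> positions D \<times> UNIV"
    using orbit_eq assms orbit_closed by (blast, blast)
  ultimately show False
    using rev_notin_orbit[of "(x, d)" S] assms(2) by metis
qed


subsection \<open>Cut points\<close>

text \<open>Along an edge the direction is constant and \<open>local_dir\<close> fails exactly at
  corners with a cut point. Through a crossing agreement persists: on entering it means that the
  corner is inward, on leaving that the partner is outward.\<close>

lemma agrees_step:
  assumes "y \<in> positions D \<times> UNIV"
  shows "agrees (step D S y) \<longleftrightarrow> (agrees y \<noteq> passes_cut (fst y) (fst (step D S y)))"
proof -
  obtain x d where y: "y = (x, d)" "x \<in> positions D"
    using assms by auto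
  from y(2) show ?thesis
  proof (cases rule: position_cases)
    case (1 u)
    show ?thesis
    proof (cases d)
      case True
      then show ?thesis
        using 1 y next_in_heads[of u]
        by (cases "next D u") (auto simp: agrees_def passes_cut_def has_cut_def doubleton_eq_iff)
    next
      case False
      then show ?thesis
        using 1 y by (cases u) (auto simp: agrees_def passes_cut_def has_cut_def doubleton_eq_iff)
    qed
  next
    case (3 c k)
    show ?thesis
    proof (cases "d = incoming k")
      case True
      then show ?thesis
        using 3 y by (auto simp: agrees_def passes_cut_def Let_def doubleton_eq_iff)
    next
      case False
      then show ?thesis
        using 3 y by (auto simp: agrees_def passes_cut_def has_cut_def doubleton_eq_iff)
    qed
  qed (auto simp: agrees_def passes_cut_def y doubleton_eq_iff)
qed

lemma agrees_funpow_step: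
  assumes "y \<in> positions D \<times> UNIV"
  shows "agrees ((step D S ^^ n) y) \<longleftrightarrow>
    (agrees y \<noteq> odd (card {i. i < n \<and>
       passes_cut (fst ((step D S ^^ i) y)) (fst ((step D S ^^ Suc i) y))}))"
proof (induction n)
  case (Suc n)
  let ?p = "\<lambda>i. passes_cut (fst ((step D S ^^ i) y)) (fst ((step D S ^^ Suc i) y))"
  have "{i. i < Suc n \<and> ?p i} = {i. i < n \<and> ?p i} \<union> (if ?p n then {n} else {})"
    by (auto simp: less_Suc_eq)
  then have "card {i. i < Suc n \<and> ?p i} = card {i. i < n \<and> ?p i} + (if ?p n then 1 else 0)"
    by simp
  moreover have "(step D S ^^ n) y \<in> positions D \<times> UNIV"
    using assms funpow_in_orbit orbit_closed by blast
  ultimately show ?case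
    using Suc agrees_step[of "(step D S ^^ n) y" S] by auto
qed simp

text \<open>\<open>z\<close> is the first visit to \<open>T\<close>. The parity only compares
  agreement at the two ends of the walk, so which point of \<open>T\<close> is met first can stay
  hidden.\<close>

lemma odd_cuts_witness:
  assumes "y \<in> positions D \<times> UNIV" "fst ` orbit (step D S) y \<inter> T \<noteq> {}"
  obtains z where "z \<in> orbit (step D S) y" "fst z \<in> T"
    "odd_cuts D S y T \<longleftrightarrow> agrees z \<noteq> agrees y"
proof -
  define n where "n = (LEAST n. fst ((step D S ^^ n) y) \<in> T)"
  have "\<exists>n. fst ((step D S ^^ n) y) \<in> T"
    using assms by (auto simp: orbit_eq_funpow)
  then have "fst ((step D S ^^ n) y) \<in> T"
    unfolding n_def by (rule LeastI_ex)
  moreover have "odd_cuts D S y T \<longleftrightarrow> agrees ((step D S ^^ n) y) \<noteq> agrees y"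
    unfolding odd_cuts_def n_def[symmetric] Let_def using agrees_funpow_step[OF assms(1)] by auto
  moreover have "(step D S ^^ n) y \<in> orbit (step D S) y"
    using assms(1) funpow_in_orbit by blast
  ultimately show thesis
    using that by blast
qed

end


lemma site_iff: "x \<in> site c \<longleftrightarrow> (\<exists>k. x = At (Corner c k))"
  by (auto simp: site_def)

lemma entering_site_iff: "entering_site c y \<longleftrightarrow> (\<exists>k. y = (At (Corner c k), incoming k))"
  by (cases "(c, y)" rule: entering_site.cases) auto

lemma step_eq_step:
  assumes "\<not> entering_site c y" "S - {c} = T - {c}"
  shows "step D S y = step D T y"
proof -
  have "vertical D S c' = vertical D T c'" if "c' \<noteq> c" for c'
    using assms(2) that by (auto simp: vertical_def)
  then show ?thesis
    using assms(1) by (cases "(D, S, y)" rule: step.cases) (auto simp: Let_def)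
qed

context closed_diagram
begin

subsection \<open>The two arcs at a crossing\<close>

lemma step_entering:
  "step D S (At (Corner c k), incoming k) =
     (At (Corner c (partner (vertical D S c) k)), \<not> incoming (partner (vertical D S c) k))"
  by (simp add: Let_def)

text \<open>The two ends of an arc agree or disagree together under either smoothing, since
  \<open>partner\<close> exchanges inward and outward.\<close>

lemma agrees_step_entering:
  assumes "entering_site c y"
  shows "fst y \<in> site c" "fst (step D S y) \<in> site c" "agrees (step D S y) \<longleftrightarrow> agrees y"
  using assms by (auto simp: entering_site_iff site_iff Let_def agrees_def)

lemma partner_in_circle:
  assumes "c \<in> crossings D"
  shows "At (Corner c (partner (vertical D S c) k)) \<in> circle D S (At (Corner c k))"
proof -
  have "step D S (At (Corner c k), incoming k) \<in> orbit (step D S) (At (Corner c k), incoming k)"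
    by (rule orbit.base)
  then show ?thesis
    using assms circle_eq[of "At (Corner c k)" S "incoming k"] unfolding step_entering by force
qed

text \<open>Each arc has one inward end, so a circle through any corner of \<open>c\<close> can be
  named by an inward corner, \<open>SW\<close> or \<open>NE\<close>.\<close>

lemma circle_corner_eq:
  assumes "c \<in> crossings D"
  obtains k where "source_sink_in k" "circle D S (At (Corner c k)) = circle D S (At (Corner c a))"
    "k = a \<or> k = partner (vertical D S c) a"
proof (cases "source_sink_in a")
  case False
  have "circle D S (At (Corner c (partner (vertical D S c) a))) = circle D S (At (Corner c a))"
    using assms partner_in_circle by (intro circle_eq_circle) auto
  with False show ?thesis
    using that source_sink_in_partner by blast
qed (use that in blast)

text \<open>
  Coherence fails on edges turning one circle into one circle, but there both edge maps vanish.
\<close>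

definition coherent :: "'c set \<Rightarrow> 'c \<Rightarrow> bool" where
  "coherent S c \<longleftrightarrow>
     (\<forall>y \<in> positions D \<times> UNIV. \<forall>z \<in> orbit (step D S) y.
        fst y \<in> site c \<longrightarrow> fst z \<in> site c \<longrightarrow> agrees y \<longrightarrow> agrees z)"

lemma coherentD:
  assumes "coherent S c" "y \<in> positions D \<times> UNIV" "z \<in> orbit (step D S) y" "z' \<in> orbit (step D S) y"
    "fst z \<in> site c" "fst z' \<in> site c"
  shows "agrees z \<longleftrightarrow> agrees z'"
proof -
  have "z \<in> positions D \<times> UNIV" "z' \<in> positions D \<times> UNIV"
    using assms(2-4) orbit_closed by (blast, blast)
  moreover have "z' \<in> orbit (step D S) z" "z \<in> orbit (step D S) z'"
    using same_orbit assms(2-4) by (blast, blast)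
  ultimately show ?thesis
    using assms(1,5,6) unfolding coherent_def by blast
qed

text \<open>A circle through the site then contains only one of the two arcs, and the two ends of
  one arc agree simultaneously.\<close>

lemma coherent_if_distinct:
  assumes c: "c \<in> crossings D"
    and distinct: "circle D S (At (Corner c SW)) \<noteq> circle D S (At (Corner c NE))"
  shows "coherent S c"
  unfolding coherent_def
proof (intro ballI impI)
  fix y z
  assume y: "y \<in> positions D \<times> UNIV" and z: "z \<in> orbit (step D S) y"
    and site: "fst y \<in> site c" "fst z \<in> site c" and agr: "agrees y"
  obtain a d b e where yz: "y = (At (Corner c a), d)" "z = (At (Corner c b), e)"
    using site by (cases y, cases z) (auto simp: site_iff)
  let ?v = "vertical D S c"
  have "circle D S (At (Corner c a)) = fst ` orbit (step D S) y"
    using y yz by (simp add: circle_eq)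
  then have "At (Corner c b) \<in> circle D S (At (Corner c a))"
    using z yz by force
  then have circles: "circle D S (At (Corner c b)) = circle D S (At (Corner c a))"
    using c by (intro circle_eq_circle) auto
  obtain k where k: "source_sink_in k" "circle D S (At (Corner c k)) = circle D S (At (Corner c a))"
      "k = a \<or> k = partner ?v a"
    using circle_corner_eq[OF c] by blast
  obtain l where l: "source_sink_in l" "circle D S (At (Corner c l)) = circle D S (At (Corner c b))"
      "l = b \<or> l = partner ?v b"
    using circle_corner_eq[OF c] by blast
  \<comment> \<open>Both are inward corners on the same circle, so they can only be
    \<open>SW\<close> twice or \<open>NE\<close> twice; hence \<open>a\<close> and \<open>b\<close>
    are ends of one arc.\<close>
  have "k = l"
    using k(1,2) l(1,2) circles distinct by (auto simp: source_sink_in_def)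
  then consider "b = a" | "b = partner ?v a"
    using k(3) l(3) partner_partner by metis
  then show "agrees z"
  proof cases
    case 1
    then have "z = y"
      using orbit_direction_unique[of "At (Corner c a)" d S y e] self_in_orbit[OF y] y z yz by simp
    then show ?thesis using agr by simp
  next
    case 2
    show ?thesis
    proof (cases "d = incoming a")
      case True
      then have s: "step D S y = (At (Corner c b), \<not> incoming b)"
        using 2 yz step_entering by simp
      then have "(At (Corner c b), \<not> incoming b) \<in> orbit (step D S) y"
        using orbit.base[of "step D S" y] by simp
      from orbit_direction_unique[OF this z[unfolded yz(2)] y] have "z = step D S y"
        using s yz(2) by simp
      then show ?thesis
        using agr True yz(1) agrees_step_entering(3)[of c y] by (simp add: entering_site_iff)
    next
      case False
      \<comment> \<open>Now \<open>y\<close> leaves the crossing, so it is the step that follows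
        entering at the other end of the arc.\<close>
      let ?u = "(At (Corner c b), incoming b) :: ('c, 'p) position \<times> bool"
      have u: "?u \<in> positions D \<times> UNIV"
        using c by simp
      have s: "step D S ?u = y"
        using False yz 2 by (auto simp: Let_def)
      then have "y \<in> orbit (step D S) ?u"
        using orbit.base by metis
      then have "?u \<in> orbit (step D S) y"
        using orbit_symmetric[OF _ u] by blast
      from orbit_direction_unique[OF this z[unfolded yz(2)] y] have "z = ?u"
        using yz(2) by simp
      then show ?thesis
        using agr s agrees_step_entering(3)[of c ?u S] by (simp add: entering_site_iff)
    qed
  qed
qed

text \<open>
  The union of the \<open>T\<close>-circles through the agreeing directed corners of \<open>c\<close> is also invariant
  under travelling on \<open>S\<close>, since at \<open>c\<close> both smoothings lead from agreeing to agreeing corners.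
\<close>

lemma coherent_transfer:
  assumes "coherent T c" "S - {c} = T - {c}"
  shows "coherent S c"
  unfolding coherent_def
proof (intro ballI impI)
  fix y z
  assume y: "y \<in> positions D \<times> UNIV" and z: "z \<in> orbit (step D S) y"
    and site: "fst y \<in> site c" "fst z \<in> site c" and agr: "agrees y"
  define U where
    "U = (\<Union>a \<in> {a \<in> positions D \<times> UNIV. fst a \<in> site c \<and> agrees a}. orbit (step D T) a)"
  have self_U: "x \<in> U" if "x \<in> positions D \<times> UNIV" "fst x \<in> site c" "agrees x" for x
    unfolding U_def using that self_in_orbit[of x] by blast
  have agrees_U: "agrees x" if "x \<in> U" "fst x \<in> site c" for x
    using assms(1) that unfolding U_def coherent_def by blast
  have step_U: "step D S x \<in> U" if x: "x \<in> U" for x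
  proof (cases "entering_site c x")
    case True
    \<comment> \<open>On entering \<open>c\<close> the walk on \<open>S\<close> may leave the orbit
      on \<open>T\<close>, but it lands at an agreeing corner, whose orbit also belongs to
      \<open>U\<close>.\<close>
    have "x \<in> positions D \<times> UNIV"
      using x orbit_closed unfolding U_def by blast
    then have "step D S x \<in> positions D \<times> UNIV"
      by (rule map_closed)
    then show ?thesis
      using self_U[of "step D S x"] agrees_U[OF x] agrees_step_entering[OF True] by metis
  next
    case False
    then have "step D S x = step D T x"
      using assms(2) by (rule step_eq_step)
    then show ?thesis
      using x unfolding U_def by (auto intro: orbit.step)
  qed
  from z have "z \<in> U"
    by (induction rule: orbit.induct) (auto intro: step_U self_U y site agr)
  then show "agrees z"
    using agrees_U site by blast
qed

text \<open>Coherence gives all corners of the site on the circle the status of \<open>z\<close>,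
  and at an inward corner agreement means entering the crossing there, which is what
  \<open>disagrees\<close> tests.\<close>

lemma disagrees_iff:
  assumes "coherent S c" "c \<in> crossings D" and y: "y \<in> positions D \<times> UNIV"
    and z: "z \<in> orbit (step D S) y" "fst z \<in> site c"
  shows "disagrees (orbit (step D S) y) c (vertical D S c) \<longleftrightarrow> \<not> agrees z"
proof -
  let ?Q = "orbit (step D S) y"
  have *: "(At (Corner c k), incoming k) \<in> ?Q \<longleftrightarrow> agrees z"
    if k: "source_sink_in k" "At (Corner c k) \<in> fst ` ?Q" for k
  proof -
    obtain d where d: "(At (Corner c k), d) \<in> ?Q"
      using k(2) by auto
    have "agrees z \<longleftrightarrow> agrees (At (Corner c k) :: ('c, 'p) position, d)"
      using coherentD[OF assms(1) y z(1) d] z(2) by (simp add: site_iff)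
    also have "\<dots> \<longleftrightarrow> d = incoming k"
      using k by (auto simp: agrees_def)
    also have "\<dots> \<longleftrightarrow> (At (Corner c k), incoming k) \<in> ?Q"
      using d orbit_direction_unique[OF d _ y, of "incoming k"] by auto
    finally show ?thesis by simp
  qed
  obtain a d where a: "z = (At (Corner c a), d)"
    using z(2) by (cases z) (auto simp: site_iff)
  have Q: "circle D S (At (Corner c a)) = fst ` ?Q"
    using orbit_eq[OF z(1) y] circle_eq[of "At (Corner c a)" S d] assms(2) a by simp
  \<comment> \<open>An inward corner on the circle is exhibited so that the existential in
    \<open>disagrees\<close> has a candidate.\<close>
  obtain k where k: "source_sink_in k" "circle D S (At (Corner c k)) = circle D S (At (Corner c a))"
    using circle_corner_eq[OF assms(2)] by blast
  then have "At (Corner c k) \<in> fst ` ?Q"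
    using Q circle_refl[of "At (Corner c k)" S] assms(2) by auto
  moreover have "disagrees ?Q c (vertical D S c) \<longleftrightarrow>
      (\<exists>k. source_sink_in k \<and> At (Corner c k) \<in> fst ` ?Q \<and> (At (Corner c k), incoming k) \<notin> ?Q)"
    unfolding disagrees_def by (simp add: Bex_def site_arcs_iff)
  ultimately show ?thesis
    using * k(1) by blast
qed


subsection \<open>Numbered circles\<close>

lemma circle_sym:
  "x \<in> positions D \<Longrightarrow> y \<in> positions D \<Longrightarrow> y \<in> circle D S x \<longleftrightarrow> x \<in> circle D S y"
  using circle_eq_circle circle_refl by blast

context
  fixes bp S K
  assumes bp: "base_points D bp" and S: "S \<subseteq> crossings D"
    and K: "K = map (circle D S) (bp S)"
begin

lemma base_point_in_positions: "i < length K \<Longrightarrow> bp S ! i \<in> positions D"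
  using bp S nth_mem[of i "bp S"] by (auto simp: base_points_def K simp del: nth_mem)

text \<open>\<open>base_points\<close> puts one base point on the circle of each position; symmetry
  of lying on a common circle turns this into one numbered circle per position.\<close>

lemma ex1_index:
  assumes "x \<in> positions D"
  shows "\<exists>!i. i < length K \<and> x \<in> K ! i"
proof -
  have "\<exists>!i. i < length K \<and> bp S ! i \<in> circle D S x"
    using bp S assms by (auto simp: base_points_def K)
  moreover have "i < length K \<and> bp S ! i \<in> circle D S x \<longleftrightarrow> i < length K \<and> x \<in> K ! i" for i
    using circle_sym[OF assms] base_point_in_positions[of i] by (auto simp: K)
  ultimately show ?thesis by simp
qed

lemma index_of_less: "x \<in> positions D \<Longrightarrow> index_of K x < length K"
  and in_nth_index_of: "x \<in> positions D \<Longrightarrow> x \<in> K ! index_of K x"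
  using theI'[OF ex1_index] by (auto simp: index_of_def)

lemma nth_index_of:
  assumes "x \<in> positions D"
  shows "K ! index_of K x = circle D S x"
proof -
  let ?i = "index_of K x"
  have "x \<in> circle D S (bp S ! ?i)"
    using in_nth_index_of[OF assms] index_of_less[OF assms] by (simp add: K)
  then have "circle D S x = circle D S (bp S ! ?i)"
    using base_point_in_positions index_of_less[OF assms] by (intro circle_eq_circle)
  then show ?thesis
    using index_of_less[OF assms] by (simp add: K)
qed

text \<open>For either \<open>v\<close>, \<open>involved\<close> lists the circles through
  \<open>SW\<close> and \<open>NE\<close> without repetition, so length 2 means that these circles
  differ.\<close>

lemma coherent_if_two_involved:
  assumes "c \<in> crossings D" "length (involved K c v) = 2"
  shows "coherent S c"
proof (rule coherent_if_distinct[OF assms(1)], rule notI)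
  assume "circle D S (At (Corner c SW)) = circle D S (At (Corner c NE))"
  then have "At (Corner c NE) \<in> circle D S (At (Corner c SW))"
    using circle_refl assms(1) by auto
  then have "index_of K (At (Corner c NE)) = index_of K (At (Corner c SW))"
    using ex1_index[of "At (Corner c NE)"] assms(1) index_of_less in_nth_index_of nth_index_of
    by (metis corner_in_positions)
  then show False
    using assms(2) by (auto simp: involved_def site_arcs_def split: if_splits)
qed

lemma set_involved:
  "set (involved K c v) = {index_of K (At (Corner c SW)), index_of K (At (Corner c NE))}"
  by (auto simp: involved_def site_arcs_def)

lemma involved_less: "c \<in> crossings D \<Longrightarrow> i \<in> set (involved K c v) \<Longrightarrow> i < length K"
  using index_of_less by (auto simp: set_involved)

text \<open>A circle meeting the site at any corner also contains \<open>SW\<close> or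
  \<open>NE\<close>, the corners from which \<open>involved\<close> is read off.\<close>

lemma involved_iff:
  assumes "c \<in> crossings D" "i < length K"
  shows "i \<in> set (involved K c v) \<longleftrightarrow> K ! i \<inter> site c \<noteq> {}"
proof
  assume "i \<in> set (involved K c v)"
  then show "K ! i \<inter> site c \<noteq> {}"
    using in_nth_index_of[of "At (Corner c _)"] assms(1) by (auto simp: set_involved site_def)
next
  assume "K ! i \<inter> site c \<noteq> {}"
  then obtain a where a: "At (Corner c a) \<in> K ! i"
    by (auto simp: site_iff)
  have Ki: "K ! i = circle D S (bp S ! i)"
    using assms(2) by (simp add: K)
  obtain k where k: "source_sink_in k" "circle D S (At (Corner c k)) = circle D S (At (Corner c a))"
    using circle_corner_eq[OF assms(1)] by blast
  have "circle D S (At (Corner c a)) = K ! i"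
    using circle_eq_circle a base_point_in_positions[OF assms(2)] unfolding Ki by blast
  then have "At (Corner c k) \<in> K ! i"
    using k(2) circle_refl assms(1) by (metis corner_in_positions)
  then have "i = index_of K (At (Corner c k))"
    using ex1_index[of "At (Corner c k)"] index_of_less in_nth_index_of assms
    by (metis corner_in_positions)
  then show "i \<in> set (involved K c v)"
    using k(1) by (auto simp: set_involved source_sink_in_def)
qed

end

text \<open>A circle that misses the site never consults the smoothing of \<open>c\<close>, so it is
  the same oriented set in both states.\<close>

lemma orbit_away_from_site:
  assumes "y \<in> positions D \<times> UNIV" "fst ` orbit (step D S) y \<inter> site c = {}" "S - {c} = T - {c}"
  shows "orbit (step D T) y = orbit (step D S) y"
proof (rule orbit_cong0[symmetric])
  show "y \<in> orbit (step D S) y"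
    using assms(1) by (rule self_in_orbit)
  show "step D S \<in> orbit (step D S) y \<rightarrow> orbit (step D S) y"
    by (auto intro: orbit.step)
  show "step D S x = step D T x" if "x \<in> orbit (step D S) y" for x
  proof (rule step_eq_step[OF _ assms(3)])
    show "\<not> entering_site c x"
      using that assms(2) by (auto simp: entering_site_iff site_iff)
  qed
qed

end

text \<open>The two sides may live over different types of positions, so only lengths and indices
  are compared. The bars at the site have to match only where two circles are involved before or
  after; otherwise the algebra factor is 0, as on edges from one circle to one circle.\<close>

lemma edge_coeff_cong:
  assumes "length K = length J" "length K' = length J'"
    and "\<And>k. index_of K (At (Corner c k)) = index_of J (At (Corner c k))"
    and "\<And>k. index_of K' (At (Corner c k)) = index_of J' (At (Corner c k))"
    and cp: "\<And>p. p \<in> set (uninvolved K c v) \<Longrightarrow> counterpart K K' p = counterpart J J' p"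
    and f: "\<And>i. length (involved K c v) = 2 \<or> length (involved K' c (\<not> v)) = 2 \<Longrightarrow>
      i \<in> set (involved K c v) \<Longrightarrow> f i = h i"
    and f': "\<And>i. length (involved K c v) = 2 \<or> length (involved K' c (\<not> v)) = 2 \<Longrightarrow>
      i \<in> set (involved K' c (\<not> v)) \<Longrightarrow> f' i = h' i"
    and g: "\<And>p. p \<in> set (uninvolved K c v) \<Longrightarrow>
      g p (counterpart K K' p) = e p (counterpart K K' p)"
  shows "edge_coeff K K' c v f f' g w w' = edge_coeff J J' c v h h' e w w'"
proof -
  have I: "involved J c v = involved K c v" "involved J' c (\<not> v) = involved K' c (\<not> v)"
    using assms(3,4) by (simp_all add: involved_def)
  have R: "uninvolved J c v = uninvolved K c v"
    using assms(1) I by (simp add: uninvolved_def)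
  have R': "map (counterpart J J') (uninvolved K c v) = map (counterpart K K') (uninvolved K c v)"
    using cp by simp
  have G: "(\<Prod>p\<in>set (uninvolved K c v). let q = counterpart J J' p in
         if w ! p = w' ! q then bar_if (e p q) (w ! p) else 0) =
       (\<Prod>p\<in>set (uninvolved K c v). let q = counterpart K K' p in
         if w ! p = w' ! q then bar_if (g p q) (w ! p) else 0)"
    using cp g by (intro prod.cong) (auto simp: Let_def)
  show ?thesis
  proof (cases "length (involved K c v) = 2 \<or> length (involved K' c (\<not> v)) = 2")
    case True
    have "(\<Prod>i\<in>set (involved K c v). bar_if (f i) (w ! i)) =
        (\<Prod>i\<in>set (involved K c v). bar_if (h i) (w ! i))"
      using f[OF True] by (intro prod.cong) auto
    moreover have "(\<Prod>i\<in>set (involved K' c (\<not> v)). bar_if (f' i) (w' ! i)) =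
        (\<Prod>i\<in>set (involved K' c (\<not> v)). bar_if (h' i) (w' ! i))"
      using f'[OF True] by (intro prod.cong) auto
    ultimately show ?thesis
      unfolding edge_coeff_def I R R' Let_def using G[unfolded Let_def] by simp
  next
    case False
    then have "(case (involved K c v, involved K' c (\<not> v)) of
          ([i, j], [k]) \<Rightarrow> mult_coeff (w ! i) (w ! j) (w' ! k)
        | ([i], [k, l]) \<Rightarrow> comult_coeff (w ! i) (w' ! k, w' ! l)
        | _ \<Rightarrow> 0) = 0"
      by (auto split: list.splits)
    then show ?thesis
      unfolding edge_coeff_def I R Let_def by simp
  qed
qed


section \<open>Collapsing parts of circles\<close>

text \<open>Positions may be identified only if in every state they lie on one circle with equal
  directions, and corners are kept. Hence no circles are merged, no orientation is lost and the
  sites are untouched.\<close>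

locale collapsed_diagram = closed_diagram D
  for D :: "('c, 'p, 'z) diagram_scheme" +
  fixes \<kappa> :: "('c, 'p) position \<Rightarrow> ('c, 'q) position"
  assumes collapse_corner_iff: "\<kappa> x = At (Corner c k) \<longleftrightarrow> x = At (Corner c k)"
    and collapse_eq_imp: "x \<in> positions D \<Longrightarrow> y \<in> positions D \<Longrightarrow> \<kappa> x = \<kappa> y \<Longrightarrow>
      (y, d) \<in> orbit (step D S) (x, d)"
begin

text \<open>Orbits are saturated with respect to \<open>\<kappa>\<close>, so an inclusion between
  images lifts, even between two different states.\<close>

lemma orbit_subset_if_collapsed:
  assumes "y \<in> positions D \<times> UNIV" "z \<in> positions D \<times> UNIV"
    and "map_prod \<kappa> id ` orbit (step D S) y \<subseteq> map_prod \<kappa> id ` orbit (step D T) z"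
  shows "orbit (step D S) y \<subseteq> orbit (step D T) z"
proof
  fix a assume a: "a \<in> orbit (step D S) y"
  obtain x d where x: "a = (x, d)"
    by (cases a)
  then have "(\<kappa> x, d) \<in> map_prod \<kappa> id ` orbit (step D S) y"
    using a by force
  then obtain x' where x': "(x', d) \<in> orbit (step D T) z" "\<kappa> x = \<kappa> x'"
    using assms(3) by auto
  have "x \<in> positions D" "x' \<in> positions D"
    using a x x' assms(1,2) orbit_closed by (blast, blast)
  then have "(x, d) \<in> orbit (step D T) (x', d)"
    using x'(2) by (simp add: collapse_eq_imp)
  then show "a \<in> orbit (step D T) z"
    using x x'(1) orbit_trans by metis
qed

lemma collapsed_orbit_eq_iff:
  assumes "y \<in> positions D \<times> UNIV" "z \<in> positions D \<times> UNIV"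
  shows "map_prod \<kappa> id ` orbit (step D S) y = map_prod \<kappa> id ` orbit (step D T) z \<longleftrightarrow>
    orbit (step D S) y = orbit (step D T) z"
  using orbit_subset_if_collapsed[OF assms, of S T]
    orbit_subset_if_collapsed[OF assms(2,1), of T S] by auto

lemma circle_subset_if_collapsed:
  assumes "a \<in> positions D" "b \<in> positions D" "\<kappa> ` circle D S a \<subseteq> \<kappa> ` circle D T b"
  shows "circle D S a \<subseteq> circle D T b"
proof
  fix x assume x: "x \<in> circle D S a"
  then obtain x' where x': "x' \<in> circle D T b" "\<kappa> x' = \<kappa> x"
    using assms(3) by (fastforce simp: image_subset_iff image_iff)
  have "x \<in> positions D" "x' \<in> positions D"
    using x x' assms(1,2) circle_subset by (blast, blast)
  then have "(x, True) \<in> orbit (step D T) (x', True)"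
    using x'(2) by (simp add: collapse_eq_imp)
  then have "x \<in> circle D T x'"
    unfolding circle_def oriented_circle_def by force
  then show "x \<in> circle D T b"
    using circle_eq_circle[OF assms(2) x'(1)] by simp
qed

lemma collapsed_circle_eq_iff:
  assumes "a \<in> positions D" "b \<in> positions D"
  shows "\<kappa> ` circle D S a = \<kappa> ` circle D T b \<longleftrightarrow> circle D S a = circle D T b"
  using circle_subset_if_collapsed[OF assms, of S T]
    circle_subset_if_collapsed[OF assms(2,1), of T S] by auto

lemma corner_in_collapsed_iff: "At (Corner c k) \<in> \<kappa> ` M \<longleftrightarrow> At (Corner c k) \<in> M"
  using collapse_corner_iff by (metis imageE imageI)

lemma disagrees_collapsed: "disagrees (map_prod \<kappa> id ` Q) c v \<longleftrightarrow> disagrees Q c v"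
proof -
  have "fst ` map_prod \<kappa> id ` Q = \<kappa> ` fst ` Q"
    by force
  moreover have "(At (Corner c k), d) \<in> map_prod \<kappa> id ` Q \<longleftrightarrow> (At (Corner c k), d) \<in> Q" for k d
  proof
    assume "(At (Corner c k), d) \<in> map_prod \<kappa> id ` Q"
    then obtain x where "(x, d) \<in> Q" "\<kappa> x = At (Corner c k)"
      by auto
    then show "(At (Corner c k), d) \<in> Q"
      by (simp add: collapse_corner_iff)
  next
    assume "(At (Corner c k), d) \<in> Q"
    then have "map_prod \<kappa> id (At (Corner c k), d) \<in> map_prod \<kappa> id ` Q"
      by (rule imageI)
    moreover have "\<kappa> (At (Corner c k)) = At (Corner c k)"
      by (simp add: collapse_corner_iff)
    ultimately show "(At (Corner c k), d) \<in> map_prod \<kappa> id ` Q"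
      by simp
  qed
  ultimately show ?thesis
    by (simp add: disagrees_def corner_in_collapsed_iff)
qed

lemma index_of_collapsed:
  "index_of (map ((`) \<kappa>) K) (At (Corner c k)) = index_of K (At (Corner c k))"
  unfolding index_of_def
  by (rule arg_cong[where f = The]) (auto simp: corner_in_collapsed_iff)

section \<open>Equality of corresponding edge maps\<close>

context
  fixes bp oc S c T K K'
  assumes bp: "base_points D bp" and S: "S \<subseteq> crossings D" and c: "c \<in> crossings D" "c \<notin> S"
    and oc: "\<And>U. U \<subseteq> crossings D \<Longrightarrow>
      oc U = map (\<lambda>b. map_prod \<kappa> id ` oriented_circle D U (b, local_dir b)) (bp U)"
    and T: "T = insert c S"
    and K: "K = map (circle D S) (bp S)" and K': "K' = map (circle D T) (bp T)"
begin

lemma T_subset: "T \<subseteq> crossings D" and S_T: "S - {c} = T - {c}"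
  and vertical_T: "vertical D T c = (\<not> vertical D S c)"
  using S c by (auto simp: T vertical_def)

lemma collapsed_numbering:
  assumes "U \<subseteq> crossings D"
  shows "map ((`) fst) (oc U) = map ((`) \<kappa>) (map (circle D U) (bp U))"
proof -
  have "fst ` map_prod \<kappa> id ` oriented_circle D U (b, local_dir b) = \<kappa> ` circle D U b"
    if "b \<in> set (bp U)" for b
  proof -
    have "b \<in> positions D"
      using that bp assms by (auto simp: base_points_def)
    then have "circle D U b = fst ` oriented_circle D U (b, local_dir b)"
      unfolding oriented_circle_def by (rule circle_eq)
    then show ?thesis
      by force
  qed
  then show ?thesis
    using oc[OF assms] by simp
qed

text \<open>A merge has two circles before and a split has two after; the coherence obtained on that
  side transfers to the other.\<close>

lemma coherent_both:
  assumes "length (involved K c v) = 2 \<or> length (involved K' c v') = 2"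
  shows "coherent S c \<and> coherent T c"
  using assms coherent_if_two_involved[OF bp S K c(1)] coherent_if_two_involved[OF bp T_subset K' c(1)]
    coherent_transfer[OF _ S_T] coherent_transfer[OF _ S_T[symmetric]] by blast

text \<open>The nearby rule before the bifurcation: the walk starts in agreement at the base point,
  so odd parity means that the first corner reached disagrees, and by coherence this decides for the
  site.\<close>

lemma odd_cuts_before_iff_disagrees:
  assumes "coherent S c" "i \<in> set (involved K c v)"
  shows "odd_cuts D S (bp S ! i, local_dir (bp S ! i)) (site c) \<longleftrightarrow>
    disagrees (oc S ! i) c (vertical D S c)"
proof -
  let ?y = "(bp S ! i, local_dir (bp S ! i))"
  have i: "i < length K"
    using involved_less[OF bp S K c(1) assms(2)] .
  then have pos: "bp S ! i \<in> positions D"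
    using base_point_in_positions[OF bp S K] by blast
  then have y: "?y \<in> positions D \<times> UNIV"
    by simp
  have "K ! i = fst ` orbit (step D S) ?y"
    using i circle_eq[OF pos] by (simp add: K)
  then have "fst ` orbit (step D S) ?y \<inter> site c \<noteq> {}"
    using involved_iff[OF bp S K c(1) i] assms(2) by metis
  then obtain z where z: "z \<in> orbit (step D S) ?y" "fst z \<in> site c"
      "odd_cuts D S ?y (site c) \<longleftrightarrow> agrees z \<noteq> agrees ?y"
    using odd_cuts_witness[OF y] by metis
  have "oc S ! i = map_prod \<kappa> id ` orbit (step D S) ?y"
    using i oc[OF S] by (simp add: K oriented_circle_def)
  moreover have "agrees ?y"
    by (simp add: agrees_def)
  ultimately show ?thesis
    using disagrees_iff[OF assms(1) c(1) y z(1,2)] z(3) by (simp add: disagrees_collapsed)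
qed

text \<open>The nearby rule after the bifurcation. The walk runs backwards from the base point and
  so starts in disagreement, while \<open>oc\<close> holds the reversed orbit; the two reversals
  cancel.\<close>

lemma odd_cuts_after_iff_disagrees:
  assumes "coherent T c" "k \<in> set (involved K' c v)"
  shows "odd_cuts D T (bp T ! k, \<not> local_dir (bp T ! k)) (site c) \<longleftrightarrow>
    disagrees (oc T ! k) c (vertical D T c)"
proof -
  let ?y = "(bp T ! k, \<not> local_dir (bp T ! k))"
  have k: "k < length K'"
    using involved_less[OF bp T_subset K' c(1) assms(2)] .
  then have pos: "bp T ! k \<in> positions D"
    using base_point_in_positions[OF bp T_subset K'] by blast
  then have y: "?y \<in> positions D \<times> UNIV" "flip ?y \<in> positions D \<times> UNIV"
    by simp_all
  have "K' ! k = fst ` orbit (step D T) ?y"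
    using k circle_eq[OF pos] by (simp add: K')
  then have "fst ` orbit (step D T) ?y \<inter> site c \<noteq> {}"
    using involved_iff[OF bp T_subset K' c(1) k] assms(2) by metis
  then obtain z where z: "z \<in> orbit (step D T) ?y" "fst z \<in> site c"
      "odd_cuts D T ?y (site c) \<longleftrightarrow> agrees z \<noteq> agrees ?y"
    using odd_cuts_witness[OF y(1)] by metis
  have "flip z \<in> orbit (step D T) (flip ?y)"
    using z(1) y(1) by (rule rev_in_orbit)
  then have "disagrees (orbit (step D T) (flip ?y)) c (vertical D T c) \<longleftrightarrow> \<not> agrees (flip z)"
    using disagrees_iff[OF assms(1) c(1) y(2)] z(2) by simp
  moreover have "oc T ! k = map_prod \<kappa> id ` orbit (step D T) (flip ?y)"
    using k oc[OF T_subset] by (simp add: K' oriented_circle_def)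
  moreover have "\<not> agrees ?y"
    by (simp add: agrees_def)
  ultimately show ?thesis
    using z(3) by (simp add: disagrees_collapsed)
qed

text \<open>The far rule: the parity is even iff the old orientation reaches the new base point
  along its local orientation, that is, iff the two global orientations coincide.\<close>

lemma odd_cuts_uninvolved_iff:
  assumes "p \<in> set (uninvolved K c v)"
  shows "odd_cuts D S (bp S ! p, local_dir (bp S ! p)) {bp T ! counterpart K K' p} \<longleftrightarrow>
    oc S ! p \<noteq> oc T ! counterpart K K' p"
proof -
  let ?y = "(bp S ! p, local_dir (bp S ! p))"
  have p: "p < length K" "p \<notin> set (involved K c v)"
    using assms by (auto simp: uninvolved_def)
  then have pos: "bp S ! p \<in> positions D"
    using base_point_in_positions[OF bp S K] by blast
  then have y: "?y \<in> positions D \<times> UNIV"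
    by simp
  have Kp: "K ! p = fst ` orbit (step D S) ?y"
    using p circle_eq[OF pos] by (simp add: K)
  then have "fst ` orbit (step D S) ?y \<inter> site c = {}"
    using involved_iff[OF bp S K c(1) p(1)] p(2) by metis
  then have orb: "orbit (step D T) ?y = orbit (step D S) ?y"
    using orbit_away_from_site[OF y _ S_T] by simp
  then have "circle D T (bp S ! p) = K ! p"
    by (simp only: Kp circle_eq[OF pos, of T "local_dir (bp S ! p)"] orb)
  \<comment> \<open>The circle persists in \<open>T\<close>, which makes its counterpart well
    defined.\<close>
  then have ex1: "\<exists>!q. q < length K' \<and> K' ! q = K ! p"
    using ex1_index[OF bp T_subset K' pos] nth_index_of[OF bp T_subset K' pos]
      index_of_less[OF bp T_subset K' pos] circle_refl[OF pos, of T] by metis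
  define q where "q = counterpart K K' p"
  have q: "q < length K'" "K' ! q = K ! p"
    using theI'[OF ex1] by (simp_all add: q_def counterpart_def)
  have qpos: "bp T ! q \<in> positions D"
    using base_point_in_positions[OF bp T_subset K' q(1)] .
  let ?u = "(bp T ! q, local_dir (bp T ! q))"
  have u: "?u \<in> positions D \<times> UNIV"
    using qpos by simp
  have "bp T ! q \<in> K ! p"
    using q circle_refl[OF qpos, of T] by (simp add: K')
  then have "fst ` orbit (step D S) ?y \<inter> {bp T ! q} \<noteq> {}"
    using Kp by auto
  then obtain z where z: "z \<in> orbit (step D S) ?y" "fst z \<in> {bp T ! q}"
      "odd_cuts D S ?y {bp T ! q} \<longleftrightarrow> agrees z \<noteq> agrees ?y"
    using odd_cuts_witness[OF y] by metis
  have "z \<in> orbit (step D T) ?y"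
    using z(1) orb by simp
  then have orb_z: "orbit (step D T) z = orbit (step D T) ?y"
    using y by (rule orbit_eq)
  have "agrees z \<longleftrightarrow> z = ?u"
    using z(2) by (cases z) (auto simp: agrees_def)
  \<comment> \<open>Over the new base point there are only \<open>?u\<close> and its reversal, and
    the latter is never in the orbit of \<open>?u\<close>.\<close>
  also have "\<dots> \<longleftrightarrow> orbit (step D T) z = orbit (step D T) ?u"
  proof
    assume eq: "orbit (step D T) z = orbit (step D T) ?u"
    have "z \<noteq> flip ?u"
    proof
      assume "z = flip ?u"
      moreover have "z \<in> orbit (step D T) z"
        using z(1) y orbit_closed by (intro self_in_orbit) blast
      ultimately have "flip ?u \<in> orbit (step D T) ?u"
        using eq by simp
      then show False
        using rev_notin_orbit[OF u] by blast
    qed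
    then show "z = ?u"
      using z(2) by (cases z) auto
  qed simp
  also have "\<dots> \<longleftrightarrow> orbit (step D S) ?y = orbit (step D T) ?u"
    using orb orb_z by simp
  also have "\<dots> \<longleftrightarrow> oc S ! p = oc T ! q"
    using collapsed_orbit_eq_iff[OF y u, of S T] p(1) q(1) oc[OF S] oc[OF T_subset]
    by (simp add: K K' oriented_circle_def)
  finally show ?thesis
    using z(3) by (simp add: agrees_def q_def)
qed

text \<open>Different circles keep different images under \<open>\<kappa>\<close>, so the search for
  the counterpart has the same solutions.\<close>

lemma counterpart_collapsed:
  assumes "p < length K"
  shows "counterpart (map ((`) \<kappa>) K) (map ((`) \<kappa>) K') p = counterpart K K' p"
proof -
  have "\<kappa> ` (K' ! q) = \<kappa> ` (K ! p) \<longleftrightarrow> K' ! q = K ! p" if "q < length K'" for q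
    using collapsed_circle_eq_iff[of "bp T ! q" "bp S ! p" T S] assms that
      base_point_in_positions[OF bp S K] base_point_in_positions[OF bp T_subset K']
    by (simp add: K K')
  then have "q < length (map ((`) \<kappa>) K') \<and> map ((`) \<kappa>) K' ! q = map ((`) \<kappa>) K ! p \<longleftrightarrow>
      q < length K' \<and> K' ! q = K ! p" for q
    using assms by auto
  then show ?thesis
    unfolding counterpart_def by simp
qed

text \<open>Both edges are instances of \<open>edge_coeff\<close>, with numbered circles related by
  \<open>\<kappa>\<close>; \<open>D'\<close> enters only through the smoothing at
  \<open>c\<close>.\<close>

lemma DKK_edge_eq_MW_edge:
  assumes "vertical D' S c = vertical D S c"
  shows "DKK_edge D bp S c w w' = MW_edge D' oc S c w w'"
proof -
  let ?v = "vertical D S c"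
  have "edge_coeff K K' c ?v
        (\<lambda>i. odd_cuts D S (bp S ! i, local_dir (bp S ! i)) (site c))
        (\<lambda>k. odd_cuts D T (bp T ! k, \<not> local_dir (bp T ! k)) (site c))
        (\<lambda>p q. odd_cuts D S (bp S ! p, local_dir (bp S ! p)) {bp T ! q}) w w' =
      edge_coeff (map ((`) \<kappa>) K) (map ((`) \<kappa>) K') c ?v
        (\<lambda>i. disagrees (oc S ! i) c ?v) (\<lambda>k. disagrees (oc T ! k) c (\<not> ?v))
        (\<lambda>p q. oc S ! p \<noteq> oc T ! q) w w'"
  proof (rule edge_coeff_cong)
    show "counterpart K K' p = counterpart (map ((`) \<kappa>) K) (map ((`) \<kappa>) K') p"
      if "p \<in> set (uninvolved K c ?v)" for p
      using that counterpart_collapsed[of p] by (simp add: uninvolved_def)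
  qed (use coherent_both odd_cuts_before_iff_disagrees odd_cuts_after_iff_disagrees vertical_T
      odd_cuts_uninvolved_iff in \<open>auto simp: index_of_collapsed\<close>)
  then show ?thesis
    using collapsed_numbering[OF S] collapsed_numbering[OF T_subset] assms
    by (simp add: DKK_edge_def MW_edge_def Let_def K K' T)
qed

end

end


section \<open>The virtual diagram of a projective diagram\<close>

locale virtual_closure =
  fixes L :: "'c tangle" and A :: outer_arcs
  assumes projective: "projective_diagram L"
begin

abbreviation "D \<equiv> pi_diagram L A"

definition leaving :: "nat set" where
  "leaving = endpoints L - entering L"

lemma antipode_in_endpoints: "e \<in> endpoints L \<Longrightarrow> antipode L e \<in> endpoints L"
  by (auto simp: endpoints_def antipode_def)

lemma antipode_antipode: "e \<in> endpoints L \<Longrightarrow> antipode L (antipode L e) = e"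
  by (simp add: endpoints_def antipode_def mod_simps)
    (metis add.assoc mod_add_self2 mod_less mult_2)

lemma antipode_mod: "antipode L e mod pairs L = e mod pairs L"
  by (simp add: antipode_def mod_mod_cancel)

lemma endpoint_eq_or_antipode:
  assumes "e \<in> endpoints L" "e' \<in> endpoints L" "e mod pairs L = e' mod pairs L"
  shows "e' = e \<or> e' = antipode L e"
proof -
  have *: "a mod pairs L = (if a < pairs L then a else a - pairs L)" if "a \<in> endpoints L" for a
    using that by (auto simp: endpoints_def mod_if)
  have "antipode L e = (if e < pairs L then e + pairs L else e - pairs L)"
    using assms(1) by (auto simp: antipode_def endpoints_def mod_if)
  then show ?thesis
    using assms *[of e] *[of e'] by (auto split: if_splits)
qed

lemma entering_in_endpoints: "e \<in> entering L \<Longrightarrow> e \<in> endpoints L"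
  using projective by (auto simp: projective_diagram_def)

lemma antipode_entering: "e \<in> endpoints L \<Longrightarrow> antipode L e \<in> entering L \<longleftrightarrow> e \<notin> entering L"
  using projective by (auto simp: projective_diagram_def)

lemma antipode_in_leaving: "e \<in> entering L \<Longrightarrow> antipode L e \<in> leaving"
  using antipode_entering antipode_in_endpoints entering_in_endpoints by (auto simp: leaving_def)

lemma antipode_of_leaving: "e \<in> leaving \<Longrightarrow> antipode L e \<in> entering L"
  using antipode_entering by (auto simp: leaving_def)

text \<open>The orientation is compatible with the antipodal identification, so of two antipodal
  endpoints exactly one leaves the disk.\<close>

lemma leaving_unique:
  "e \<in> leaving \<Longrightarrow> e' \<in> leaving \<Longrightarrow> e mod pairs L = e' mod pairs L \<Longrightarrow> e = e'"
  using endpoint_eq_or_antipode[of e e'] antipode_entering[of e] by (auto simp: leaving_def)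

lemma entering_unique:
  "e \<in> entering L \<Longrightarrow> e' \<in> entering L \<Longrightarrow> e mod pairs L = e' mod pairs L \<Longrightarrow> e = e'"
  using endpoint_eq_or_antipode[of e e'] antipode_entering[of e] entering_in_endpoints by auto

lemma pass_points_eq: "pass_points L A = {Pass e k |e k. e \<in> leaving \<and> k < passages A e}"
  by (simp add: pass_points_def leaving_def)

lemma finite_pass_points: "finite (pass_points L A)"
proof -
  have "pass_points L A = (\<lambda>(e, k). Pass e k) ` (SIGMA e:leaving. {..<passages A e})"
    by (force simp: pass_points_eq)
  moreover have "finite leaving"
    by (simp add: leaving_def endpoints_def)
  ultimately show ?thesis
    by simp
qed

text \<open>
  The tails are those of the strands inside the disk, those on the outer arcs, and the loops; each
  of the three classes is mapped bijectively onto the corresponding class of heads.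
\<close>

lemma bij_next_D: "bij_betw (next D) (tails D) (heads D)"
proof -
  let ?m = "map_vertex id End :: ('c, nat) vertex \<Rightarrow> ('c, virtual_point) vertex"
  let ?n = "pi_next L A"
  have inj_m: "inj ?m"
    by (intro vertex.inj_map) (auto simp: inj_on_def)
  have arc: "bij_betw (arc L) (tangle_tails L) (tangle_heads L)"
    using projective by (simp add: projective_diagram_def)
  have m_corners: "?m ` {Corner c k |c k. c \<in> tcrossings L \<and> Q k} =
      {Corner c k |c k. c \<in> tcrossings L \<and> Q k}" for Q
    by (force simp: image_iff)
  have m_tails: "?m ` tangle_tails L =
      {Corner c k |c k. c \<in> tcrossings L \<and> \<not> incoming k} \<union> Point ` End ` entering L"
    using entering_in_endpoints
    by (simp add: tangle_tails_def image_Un m_corners image_image Int_absorb1 subset_iff)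
  have m_heads: "?m ` tangle_heads L =
      {Corner c k |c k. c \<in> tcrossings L \<and> incoming k} \<union> Point ` End ` leaving"
    by (simp add: tangle_heads_def image_Un m_corners image_image leaving_def)
  \<comment> \<open>Inside the disk, \<open>pi_next\<close> is \<open>arc\<close> transported along
    the injective renaming \<open>?m\<close>.\<close>
  have n_m: "?n (?m t) = ?m (arc L t)" if "t \<in> tangle_tails L" for t
    using that by (auto simp: tangle_tails_def)
  have disk: "bij_betw ?n (?m ` tangle_tails L) (?m ` tangle_heads L)"
  proof (rule bij_betw_imageI)
    show "inj_on ?n (?m ` tangle_tails L)"
      using arc n_m by (auto simp: bij_betw_def inj_eq[OF inj_m] inj_on_eq_iff intro!: inj_onI)
    have "?n ` ?m ` tangle_tails L = ?m ` arc L ` tangle_tails L"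
      using n_m by (force simp: image_iff)
    then show "?n ` ?m ` tangle_tails L = ?m ` tangle_heads L"
      using arc by (simp add: bij_betw_def)
  qed
  \<comment> \<open>The inverse of \<open>pi_next\<close> on the outer arcs. An entering
    \<open>End e\<close> comes from the arc that left at the antipode \<open>l\<close> of
    \<open>e\<close>: from its last passage, or from \<open>End l\<close> if there is none.\<close>
  define before where "before v =
      (case v of Point (Pass e k) \<Rightarrow> Point (if k = 0 then End e else Pass e (k - 1))
       | Point (End e) \<Rightarrow>
           (let l = antipode L e in Point (if passages A l = 0 then End l else Pass l (passages A l - 1)))
       | _ \<Rightarrow> v)" for v :: "('c, virtual_point) vertex"
  have outer: "bij_betw ?n (Point ` (End ` leaving \<union> pass_points L A))
      (Point ` (End ` entering L \<union> pass_points L A))"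
  proof (rule bij_betw_byWitness[where f' = before])
    show "\<forall>a\<in>Point ` (End ` leaving \<union> pass_points L A). before (?n a) = a"
      using antipode_antipode by (auto simp: before_def pass_points_eq leaving_def Let_def)
    show "\<forall>a\<in>Point ` (End ` entering L \<union> pass_points L A). ?n (before a) = a"
      using antipode_antipode antipode_in_leaving entering_in_endpoints
      by (auto simp: before_def pass_points_eq leaving_def Let_def)
    show "?n ` Point ` (End ` leaving \<union> pass_points L A)
        \<subseteq> Point ` (End ` entering L \<union> pass_points L A)"
      using antipode_of_leaving by (auto simp: pass_points_eq leaving_def)
    show "before ` Point ` (End ` entering L \<union> pass_points L A)
        \<subseteq> Point ` (End ` leaving \<union> pass_points L A)"
      using antipode_in_leaving by (auto simp: before_def pass_points_eq Let_def intro!: imageI)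
  qed
  have closed: "bij_betw ?n (Point ` VLoop ` {..<loops L}) (Point ` VLoop ` {..<loops L})"
    by (rule bij_betw_byWitness[where f' = id]) auto
  have "bij_betw ?n
      ((?m ` tangle_tails L \<union> Point ` (End ` leaving \<union> pass_points L A)) \<union> Point ` VLoop ` {..<loops L})
      ((?m ` tangle_heads L \<union> Point ` (End ` entering L \<union> pass_points L A)) \<union> Point ` VLoop ` {..<loops L})"
    by (intro bij_betw_combine disk outer closed) (auto simp: tangle_heads_def pass_points_eq)
  moreover have ends: "endpoints L = entering L \<union> leaving"
    using entering_in_endpoints by (auto simp: leaving_def)
  moreover have "tails D = (?m ` tangle_tails L \<union> Point ` (End ` leaving \<union> pass_points L A))
      \<union> Point ` VLoop ` {..<loops L}"
    by (auto simp: tails_def pi_diagram_def m_tails ends image_Un)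
  moreover have "heads D = (?m ` tangle_heads L \<union> Point ` (End ` entering L \<union> pass_points L A))
      \<union> Point ` VLoop ` {..<loops L}"
    by (auto simp: heads_def pi_diagram_def m_heads ends image_Un)
  ultimately show ?thesis
    by (simp add: pi_diagram_def)
qed

sublocale closed_diagram D
proof
  show "finite (crossings D)"
    using projective by (simp add: pi_diagram_def projective_diagram_def)
  show "finite (points D)"
    by (simp add: pi_diagram_def endpoints_def finite_pass_points)
qed (rule bij_next_D)

section \<open>Outer arcs as fibres of the collapse\<close>

lemma next_D [simp]: "next D = pi_next L A"
  by (simp add: pi_diagram_def)

lemma points_D: "points D = VLoop ` {..<loops L} \<union> End ` endpoints L \<union> pass_points L A"
  by (simp add: pi_diagram_def)

text \<open>For \<open>e\<close> leaving, the fibre of \<open>collapse\<close> over a boundary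
  point. The middle of the edge starting at the antipode is absent because it lies inside the
  disk.\<close>

definition outer_positions :: "nat \<Rightarrow> ('c, virtual_point) position set" where
  "outer_positions e =
     {At (Point (End e)), Mid (Point (End e)), At (Point (End (antipode L e)))} \<union>
     {At (Point (Pass e k)) |k. k < passages A e} \<union> {Mid (Point (Pass e k)) |k. k < passages A e}"

text \<open>An outer arc meets only bivalent points, so it is travelled alike in every state. It is
  followed forwards from its start; the other direction is the reversal.\<close>

lemma travel_outer_arc:
  assumes "e \<in> leaving" "x \<in> outer_positions e"
  shows "(x, d) \<in> orbit (step D S) (At (Point (End e)), d)"
proof -
  let ?f = "step D S" and ?a = "(At (Point (End e)) :: ('c, virtual_point) position, True)"
  have notin: "e \<notin> entering L"
    using assms(1) by (simp add: leaving_def)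
  have a: "?a \<in> positions D \<times> UNIV"
    using assms(1) by (auto simp: points_D leaving_def)
  have step: "?f z \<in> orbit ?f ?a" if "z \<in> orbit ?f ?a" for z
    using that by (rule orbit.step)
  have self: "?a \<in> orbit ?f ?a"
    using a by (rule self_in_orbit)
  have mid: "(Mid (Point (End e)), True) \<in> orbit ?f ?a"
    using step[OF self] by simp
  have pass: "(At (Point (Pass e k)), True) \<in> orbit ?f ?a \<and> (Mid (Point (Pass e k)), True) \<in> orbit ?f ?a"
    if "k < passages A e" for k
    using that
  proof (induction k)
    case 0
    then have "(At (Point (Pass e 0)), True) \<in> orbit ?f ?a"
      using step[OF mid] notin by simp
    then show ?case
      using step[of "(At (Point (Pass e 0)), True)"] by simp
  next
    case (Suc k)
    then have "(At (Point (Pass e (Suc k))), True) \<in> orbit ?f ?a"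
      using step[of "(Mid (Point (Pass e k)), True)"] by simp
    then show ?case
      using step[of "(At (Point (Pass e (Suc k))), True)"] by simp
  qed
  have last: "(At (Point (End (antipode L e))), True) \<in> orbit ?f ?a"
  proof (cases "passages A e")
    case 0
    then show ?thesis
      using step[OF mid] notin by simp
  next
    case (Suc k)
    then show ?thesis
      using pass[of k] step[of "(Mid (Point (Pass e k)), True)"] by simp
  qed
  have forward: "(x, True) \<in> orbit ?f ?a"
    using assms(2) self mid pass last by (auto simp: outer_positions_def)
  show ?thesis
  proof (cases d)
    case False
    then show ?thesis
      using rev_in_orbit[OF forward a] by simp
  qed (use forward in simp)
qed

lemma outer_tail_simps [simp]:
  "\<not> outer_tail L (Corner c k)" "\<not> outer_tail L (Point (VLoop j))"
  "outer_tail L (Point (End e)) \<longleftrightarrow> e \<notin> entering L" "outer_tail L (Point (Pass e j))"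
  by (auto simp: outer_tail_def)

text \<open>An entering endpoint belongs to the outer arc that leaves at its antipode; everything
  else over a boundary point carries the leaving endpoint in its name.\<close>

lemma collapse_boundary:
  assumes "x \<in> positions D" "collapse L x = At (Point (Bdry i))"
  shows "\<exists>e \<in> leaving. e mod pairs L = i \<and> x \<in> outer_positions e"
proof -
  have end_point: "\<exists>e' \<in> leaving. e' mod pairs L = e mod pairs L \<and>
      At (Point (End e)) \<in> outer_positions e'" if "e \<in> endpoints L" for e
  proof (cases "e \<in> entering L")
    case True
    then show ?thesis
      using antipode_in_leaving[OF True] antipode_mod[of e] antipode_antipode[OF that]
      by (intro bexI[of _ "antipode L e"]) (auto simp: outer_positions_def)
  next
    case False
    then show ?thesis
      using that by (intro bexI[of _ e]) (auto simp: outer_positions_def leaving_def)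
  qed
  from assms(1) show ?thesis
  proof (cases rule: position_cases)
    case (1 u)
    then have "outer_tail L u"
      using assms(2) by (auto split: if_splits)
    then show ?thesis
      using 1 assms(2)
      by (auto simp: outer_tail_def points_D pass_points_eq outer_positions_def leaving_def)
  next
    case (2 p)
    then show ?thesis
      using assms(2) end_point by (auto simp: points_D pass_points_eq outer_positions_def)
  qed (use assms(2) in auto)
qed

text \<open>Inside the disk only the endpoints are renamed, and a boundary point determines its
  unique entering endpoint.\<close>

lemma collapse_interior:
  assumes "x \<in> positions D" "y \<in> positions D" "collapse L x = collapse L y"
    and "\<nexists>i. collapse L x = At (Point (Bdry i))"
  shows "x = y"
proof -
  have interior: "z \<in> range (\<lambda>(c, k). At (Corner c k)) \<union> range (\<lambda>j. At (Point (VLoop j))) \<or>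
      (\<exists>u \<in> tails D. z = Mid u \<and> \<not> outer_tail L u)"
    if "z \<in> positions D" "\<nexists>i. collapse L z = At (Point (Bdry i))" for z
    using that(1)
  proof (cases rule: position_cases)
    case (1 u)
    then show ?thesis
      using that(2) by (auto simp: outer_tail_def)
  next
    case (2 p)
    then show ?thesis
      using that(2) by (cases p) auto
  qed auto
  have "u = u'" if "u \<in> tails D" "u' \<in> tails D" "\<not> outer_tail L u" "\<not> outer_tail L u'"
    "collapse_vertex L u = collapse_vertex L u'" for u u'
    using that entering_unique
    by (cases "(L, u)" rule: collapse_vertex.cases; cases "(L, u')" rule: collapse_vertex.cases) auto
  then show ?thesis
    using interior[OF assms(1,4)] interior[of y] assms by auto
qed

sublocale collapsed_diagram D "collapse L"
proof
  show "collapse L x = At (Corner c k) \<longleftrightarrow> x = At (Corner c k)" for x c k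
    by (cases x) (auto simp: outer_tail_def elim!: collapse_vertex.elims)
  fix x y d S
  assume x: "x \<in> positions D" and y: "y \<in> positions D" and eq: "collapse L x = collapse L y"
  show "(y, d) \<in> orbit (step D S) (x, d)"
  proof (cases "\<exists>i. collapse L x = At (Point (Bdry i))")
    case True
    then obtain i where i: "collapse L x = At (Point (Bdry i))" "collapse L y = At (Point (Bdry i))"
      using eq by auto
    obtain e where e: "e \<in> leaving" "x \<in> outer_positions e" "y \<in> outer_positions e"
      using collapse_boundary[OF x i(1)] collapse_boundary[OF y i(2)] leaving_unique by blast
    have "(At (Point (End e)), d) \<in> positions D \<times> UNIV"
      using e(1) by (auto simp: points_D leaving_def)
    then show ?thesis
      using same_orbit travel_outer_arc[OF e(1,2)] travel_outer_arc[OF e(1,3)] by metis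
  next
    case False
    then have "x = y"
      by (rule collapse_interior[OF x y eq])
    then show ?thesis
      using self_in_orbit[of "(x, d)"] x by simp
  qed
qed

end


section \<open>Cohomology of cube complexes\<close>

text \<open>The differential evaluates edge matrices only at \<open>T - {c}\<close> with
  \<open>c\<close> in \<open>T\<close>, hence only on edges with \<open>c\<close> outside the source
  state.\<close>

lemma cube_complex_cong:
  assumes "\<And>S. S \<subseteq> C \<Longrightarrow> n S = n' S"
    and "\<And>S c w w'. S \<subseteq> C \<Longrightarrow> c \<in> C \<Longrightarrow> c \<notin> S \<Longrightarrow> E S c w w' = E' S c w w'"
  shows "cube_complex C n E = cube_complex C n' E'"
proof -
  have "differential (cube_complex C n E) f (T, v) = differential (cube_complex C n' E') f (T, v)"
    for f T v
  proof (cases "T \<subseteq> C")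
    case True
    have "n (T - {c}) = n' (T - {c})" "n T = n' T"
      "c \<in> T \<Longrightarrow> E (T - {c}) c w v = E' (T - {c}) c w v" for c w
      using True assms by (auto intro!: assms)
    then show ?thesis
      by (simp add: cube_complex_def)
  qed (simp add: cube_complex_def)
  then have "differential (cube_complex C n E) = differential (cube_complex C n' E')"
    by (intro ext) auto
  moreover have "cochains (cube_complex C n E) = cochains (cube_complex C n' E')"
    using assms(1) by (simp add: cube_complex_def cong: conj_cong)
  ultimately show ?thesis
    by simp
qed

lemma finite_label_lists: "finite {w :: label list. length w = n}"
proof -
  have "(UNIV :: label set) = {One, X}"
    by (auto intro: label.exhaust)
  then have "finite (UNIV :: label set)"
    by (metis finite.emptyI finite_insert)
  then show ?thesis
    using finite_lists_length_eq[of UNIV n] by simp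
qed

context
  fixes L :: "'c tangle" and n :: "'c set \<Rightarrow> nat" and E K
  assumes finite_tcrossings: "finite (tcrossings L)" and K: "K = cube_complex (tcrossings L) n E"
begin

lemma cochains_iff:
  "f \<in> cochains K r \<longleftrightarrow>
     (\<forall>S w. f (S, w) \<noteq> 0 \<longrightarrow> S \<subseteq> tcrossings L \<and> card S = r \<and> length w = n S)"
  by (simp add: K cube_complex_def)

text \<open>\<open>pi_state\<close> is the identity, so \<open>alpha\<close> is a sum of delta
  functions that reproduces \<open>f\<close> on its support; the set of generators is finite, so the
  sum does not default to 0.\<close>

lemma alpha_supported:
  assumes "\<And>S w. f (S, w) \<noteq> 0 \<Longrightarrow> S \<subseteq> tcrossings L \<and> length w = n S"
  shows "alpha L n f = f"
proof
  fix g :: "'c set \<times> label list"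
  let ?G = "{(S, w :: label list). S \<subseteq> tcrossings L \<and> length w = n S}"
  have G: "?G = (SIGMA S:Pow (tcrossings L). {w. length w = n S})"
    by auto
  have "finite (SIGMA S:Pow (tcrossings L). {w :: label list. length w = n S})"
    using finite_tcrossings finite_label_lists by (intro finite_SigmaI) auto
  then have "finite ?G"
    unfolding G .
  then have "(\<Sum>x\<in>?G. if g = x then f x else 0) = (if g \<in> ?G then f g else 0)"
    by (simp add: sum.delta)
  moreover have "alpha L n f g = (\<Sum>x\<in>?G. if g = x then f x else 0)"
    unfolding alpha_def pi_state_def by (intro sum.cong) auto
  ultimately show "alpha L n f g = f g"
    using assms by (cases g) auto
qed

lemma alpha_cochain: "f \<in> cochains K r \<Longrightarrow> alpha L n f = f"
  by (rule alpha_supported) (auto simp: K cube_complex_def)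

lemma alpha_differential: "alpha L n (differential K f) = differential K f"
  by (rule alpha_supported) (auto simp: K cube_complex_def split: if_splits)

lemma cochains_add: "f \<in> cochains K r \<Longrightarrow> g \<in> cochains K r \<Longrightarrow> (\<lambda>x. f x + g x) \<in> cochains K r"
  unfolding cochains_iff by (metis add_0)

lemma cochains_scale: "f \<in> cochains K r \<Longrightarrow> (\<lambda>x. a * f x) \<in> cochains K r"
  unfolding cochains_iff by (metis mult_zero_right)

lemma differential_add: "differential K (\<lambda>x. f x + g x) = (\<lambda>x. differential K f x + differential K g x)"
  by (auto simp: K cube_complex_def fun_eq_iff sum.distrib algebra_simps)

lemma differential_cochain:
  assumes "f \<in> cochains K r"
  shows "differential K f \<in> cochains K (Suc r)"
proof -
  have "T \<subseteq> tcrossings L \<and> card T = Suc r \<and> length v = n T" if "differential K f (T, v) \<noteq> 0" for T v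
  proof -
    have T: "T \<subseteq> tcrossings L" "length v = n T"
      using that by (auto simp: K cube_complex_def split: if_splits)
    have "\<exists>c \<in> T. \<exists>w. f (T - {c}, w) \<noteq> 0"
    proof (rule ccontr)
      assume "\<not> ?thesis"
      then show False
        using that by (simp add: K cube_complex_def split: if_splits)
    qed
    then obtain c w where c: "c \<in> T" "f (T - {c}, w) \<noteq> 0"
      by blast
    then have "card (T - {c}) = r"
      using assms unfolding cochains_iff by blast
    moreover have "finite T"
      using T finite_tcrossings finite_subset by blast
    ultimately show ?thesis
      using T card_Suc_Diff1[of T c] c(1) by simp
  qed
  then show ?thesis
    unfolding cochains_iff by blast
qed

lemma coboundaries_cochains: "coboundaries K r \<subseteq> cochains K r"
proof (cases r)
  case 0
  then show ?thesis
    by (auto simp: coboundaries_def K cube_complex_def)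
next
  case (Suc s)
  then show ?thesis
    using differential_cochain[of _ s] by (auto simp: coboundaries_def)
qed

lemma coboundaries_add:
  assumes "f \<in> coboundaries K r" "g \<in> coboundaries K r"
  shows "(\<lambda>x. f x + g x) \<in> coboundaries K r"
proof (cases r)
  case (Suc s)
  then obtain f' g' where "f' \<in> cochains K s" "f = differential K f'"
      "g' \<in> cochains K s" "g = differential K g'"
    using assms by (auto simp: coboundaries_def)
  then have "(\<lambda>x. f x + g x) = differential K (\<lambda>x. f' x + g' x)" "(\<lambda>x. f' x + g' x) \<in> cochains K s"
    by (simp_all add: differential_add cochains_add)
  then show ?thesis
    using Suc by (auto simp: coboundaries_def)
qed (use assms in \<open>simp add: coboundaries_def\<close>)

lemma zero_coboundary: "(\<lambda>_. 0) \<in> coboundaries K r"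
proof (cases r)
  case (Suc s)
  have "differential K (\<lambda>_. 0) = (\<lambda>_. 0)" "(\<lambda>_. 0) \<in> cochains K s"
    by (auto simp: K cube_complex_def fun_eq_iff)
  then show ?thesis
    using Suc unfolding coboundaries_def by (metis diff_Suc_1 image_eqI nat.distinct(1))
qed (simp add: coboundaries_def)

text \<open>As \<open>alpha\<close> fixes cochains, \<open>induced\<close> only adds coboundaries:
  the result stays in \<open>Z\<close> by stability, and the zero coboundary recovers all of
  \<open>Z\<close>.\<close>

lemma induced_eq:
  assumes "Z \<subseteq> cochains K r"
    and "\<And>b z. b \<in> coboundaries K r \<Longrightarrow> z \<in> Z \<Longrightarrow> (\<lambda>x. b x + z x) \<in> Z"
  shows "induced K (alpha L n) r Z = Z"
proof
  show "induced K (alpha L n) r Z \<subseteq> Z"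
    using assms alpha_cochain by (auto simp: induced_def subset_iff)
  show "Z \<subseteq> induced K (alpha L n) r Z"
  proof
    fix z assume "z \<in> Z"
    then have "z = (\<lambda>x. (\<lambda>_. 0) x + alpha L n z x)"
      using assms(1) alpha_cochain by auto
    then show "z \<in> induced K (alpha L n) r Z"
      using zero_coboundary[of r] \<open>z \<in> Z\<close> unfolding induced_def
      by (intro CollectI exI[of _ "\<lambda>_. 0"] exI[of _ z] conjI)
  qed
qed

lemma class_cases:
  assumes "Z \<in> carrier (cohomology K r)"
  obtains z where "z \<in> cochains K r" "Z = {\<lambda>x. b x + z x |b. b \<in> coboundaries K r}"
proof -
  obtain z where "z \<in> cocycles K r" "Z = (\<Union>b\<in>coboundaries K r. {\<lambda>x. b x + z x})"
    using assms by (auto simp: cohomology_def FactGroup_def RCOSETS_def r_coset_def)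
  then show thesis
    using that[of z] by (auto simp: cocycles_def)
qed

lemma induced_class:
  assumes "Z \<in> carrier (cohomology K r)"
  shows "induced K (alpha L n) r Z = Z"
proof -
  obtain z where z: "z \<in> cochains K r" "Z = {\<lambda>x. b x + z x |b. b \<in> coboundaries K r}"
    using assms by (rule class_cases)
  show ?thesis
  proof (rule induced_eq)
    show "Z \<subseteq> cochains K r"
      using z coboundaries_cochains cochains_add by blast
    fix b y assume b: "b \<in> coboundaries K r" and "y \<in> Z"
    then obtain b' where "b' \<in> coboundaries K r" "y = (\<lambda>x. b' x + z x)"
      using z(2) by blast
    then show "(\<lambda>x. b x + y x) \<in> Z"
      using coboundaries_add[OF b, of b'] unfolding z(2)
      by (auto intro!: exI[of _ "\<lambda>x. b x + b' x"])
  qed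
qed

lemma mult_cohomology:
  "Y \<otimes>\<^bsub>cohomology K r\<^esub> Z = {\<lambda>x. y x + z x |y z. y \<in> Y \<and> z \<in> Z}"
  by (auto simp: cohomology_def FactGroup_def set_mult_def)

text \<open>The set product is stable under adding coboundaries because \<open>Y\<close> is, and
  this is what \<open>induced_eq\<close> asks for.\<close>

lemma induced_mult:
  assumes "Y \<in> carrier (cohomology K r)" "Z \<in> carrier (cohomology K r)"
  shows "induced K (alpha L n) r (Y \<otimes>\<^bsub>cohomology K r\<^esub> Z) = Y \<otimes>\<^bsub>cohomology K r\<^esub> Z"
proof -
  obtain y where y: "y \<in> cochains K r" "Y = {\<lambda>x. b x + y x |b. b \<in> coboundaries K r}"
    using assms(1) by (rule class_cases)
  obtain z where z: "z \<in> cochains K r" "Z = {\<lambda>x. b x + z x |b. b \<in> coboundaries K r}"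
    using assms(2) by (rule class_cases)
  have sub: "Y \<subseteq> cochains K r" "Z \<subseteq> cochains K r"
    using y z coboundaries_cochains cochains_add by blast+
  show ?thesis
    unfolding mult_cohomology
  proof (rule induced_eq)
    show "{\<lambda>x. y x + z x |y z. y \<in> Y \<and> z \<in> Z} \<subseteq> cochains K r"
      using sub cochains_add by blast
    fix b u assume b: "b \<in> coboundaries K r" and "u \<in> {\<lambda>x. y x + z x |y z. y \<in> Y \<and> z \<in> Z}"
    then obtain b' z' where u: "b' \<in> coboundaries K r" "z' \<in> Z" "u = (\<lambda>x. (b' x + y x) + z' x)"
      using y(2) by blast
    have "(\<lambda>x. (b x + b' x) + y x) \<in> Y"
      using coboundaries_add[OF b u(1)] unfolding y(2)
      by (auto intro!: exI[of _ "\<lambda>x. b x + b' x"])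
    moreover have "(\<lambda>x. b x + u x) = (\<lambda>x. ((b x + b' x) + y x) + z' x)"
      by (simp add: u(3) add.assoc)
    ultimately show "(\<lambda>x. b x + u x) \<in> {\<lambda>x. y x + z x |y z. y \<in> Y \<and> z \<in> Z}"
      using u(2) by (intro CollectI exI[of _ "\<lambda>x. (b x + b' x) + y x"] exI[of _ z'] conjI)
  qed
qed

lemma chain_map_alpha: "chain_map K K (alpha L n)"
  unfolding chain_map_def
  by (auto simp: alpha_cochain alpha_differential
      alpha_cochain[OF cochains_add] alpha_cochain[OF cochains_scale])

lemma induced_iso: "induced K (alpha L n) r \<in> iso (cohomology K r) (cohomology K r)"
proof -
  have "bij_betw (induced K (alpha L n) r) (carrier (cohomology K r)) (carrier (cohomology K r))"
    using induced_class by (simp add: bij_betw_def inj_on_def)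
  then show ?thesis
    using induced_class induced_mult by (auto simp: iso_def hom_def)
qed

end

section \<open>Equality of the two complexes and the isomorphism on cohomology\<close>

lemma (in virtual_closure) MW_complex_eq_DKK_complex:
  assumes bp: "base_points D bp" and cor: "corresponding L A bp oc"
  shows "DKK_complex D bp = MW_complex L oc"
proof -
  have C: "crossings D = tcrossings L"
    by (simp add: pi_diagram_def)
  have oc: "oc U = map (\<lambda>b. map_prod (collapse L) id ` oriented_circle D U (b, local_dir b)) (bp U)"
    if "U \<subseteq> crossings D" for U
    using cor that by (simp add: corresponding_def pi_state_def C)
  have vertical: "vertical (rp2_diagram L) S c = vertical D S c" for S c
    by (simp add: vertical_def rp2_diagram_def pi_diagram_def)
  have "DKK_edge D bp S c w w' = MW_edge (rp2_diagram L) oc S c w w'"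
    if "S \<subseteq> crossings D" "c \<in> crossings D" "c \<notin> S" for S c w w'
    using bp that oc refl refl refl vertical by (rule DKK_edge_eq_MW_edge)
  then show ?thesis
    unfolding DKK_complex_def MW_complex_def C[symmetric]
    using oc by (intro cube_complex_cong) simp_all
qed

theorem theorem6p4:
  fixes L :: "'c tangle" and A :: outer_arcs
    and bp :: "'c set \<Rightarrow> ('c, virtual_point) position list"
    and oc :: "'c set \<Rightarrow> (('c, rp2_point) position \<times> bool) set list"
  assumes "projective_diagram L"
    and "drawn_outside L A"
    and "base_points (pi_diagram L A) bp"
    and "oriented_numbering (rp2_diagram L) oc"
    and "corresponding L A bp oc"
  shows "chain_map (MW_complex L oc) (DKK_complex (pi_diagram L A) bp)
           (alpha L (\<lambda>S. length (oc S)))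
    \<and> (\<forall>r. induced (DKK_complex (pi_diagram L A) bp) (alpha L (\<lambda>S. length (oc S))) r
             \<in> iso (cohomology (MW_complex L oc) r)
                   (cohomology (DKK_complex (pi_diagram L A) bp) r))"
proof -
  interpret virtual_closure L A
    by unfold_locales (rule assms(1))
  have "DKK_complex (pi_diagram L A) bp = MW_complex L oc"
    using assms(3,5) by (rule MW_complex_eq_DKK_complex)
  moreover have "finite (tcrossings L)"
    using assms(1) by (simp add: projective_diagram_def)
  \<comment> \<open>With source and target equal, the results on \<open>alpha\<close> as a self-map
    of one complex apply.\<close>
  ultimately show ?thesis
    using chain_map_alpha[OF _ MW_complex_def] induced_iso[OF _ MW_complex_def] by metis
qed

end
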